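(* For each $t\in\{1,\dots,T\}$ let $S_{t-1},S_t$ (with values in $\mathcal S$), $W_{t-1}$ (with values in $\mathcal W$), $U_{t-1}$ (with values in $\mathcal U$) and $A_t$ (with values in a finite set $\mathcal A$) be random variables on a common probability space, and let $A_t^{(s)}$ be the $\mathcal A$-valued potential action under the intervention $\mathrm{do}(S_t=s)$. Assume that for all $t$: 1. (Proxy conditional independences) $S_{t-1}\perp\!\!\!\perp A_t\mid (S_t,U_{t-1})$ and $(S_{t-1},S_t)\perp\!\!\!\perp W_{t-1}\mid U_{t-1}$. 2. (Consistency) For all $s$ in the support of $S_t$: $S_t=s$ implies $A_t=A_t^{(s)}$ almost surely. 3. (Positivity) $p(S_t=s\mid U_{t-1}=u)>0$ for all $u$ in the support of $U_{t-1}$ and all $s$ in the support of $S_t$. 4. (Latent exchangeability) $A_t^{(s)}\perp\!\!\!\perp S_t\mid U_{t-1}$ for all $s$. 5. (Completeness) For each $s$ in the support of $S_t$ and any square-integrable function $\nu$, if $\mathbb E[\nu(U_{t-1})\mid S_{t-1},S_t=s]=0$ almost surely, then $\nu(U_{t-1})=0$ almost surely. 6. (Confounding bridge) For each action $a\in\mathcal A$ there exists a function $h_a:\mathcal W\times\mathcal S\to\mathbb R$ such that for all $s$ in the support of $S_t$ and all $z$ in the support of $S_{t-1}$, $$p(A_t=a\mid S_{t-1}=z,S_t=s)=\int h_a(w,s)\,p(w\mid S_{t-1}=z,S_t=s)\,dw .$$ Then the interventional action probabilities are identified by $$p\big(A_t^{(s)}=a\big)=\int h_a(w,s)\,p(w)\,dw,\qquad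 a\in\mathcal A,$$ for every $s$ in the support of $S_t$. Consequently, $\pi_{\mathrm{opt}}(s)\in\arg\max_{a\in\mathcal A}p(A_t^{(s)}=a)$ is identified for all $s$ in the support of $S_t$ (up to ties).
   Context: Interpretation: $S_t$ is an observed state, $U_t$ an unobserved latent state, $W_t$ a noisy measurement of $U_t$, $A_t$ the expert's action. The observed variables are $(S_{t-1},S_t,W_{t-1},A_t)$; a quantity is "identified" if it is determined by (is a function of) the joint distribution of the observed variables. States and measurements are continuous variables, and $p(\cdot)$ and $p(\cdot\mid\cdot)$ denote (conditional) densities, or (conditional) probabilities for the discrete variable $A_t$; $p(w)$ is the marginal density of $W_{t-1}$ and $p(w\mid S_{t-1}=z,S_t=s)$ its conditional density. The displayed integrals are presupposed to exist. The bridge function $h_a$ is any function satisfying the integral equation in hypothesis 6; it need not be unique. The policy $\pi_{\mathrm{opt}}$ is the causal imitation target, $\pi_{\mathrm{opt}}(s):=\arg\max_{a\in\mathcal A}p(A_t^{(s)}=a)$.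
   Formalization: The bridge functions h_a(·,s) are additionally required to be measurable with E[h_a(W_{t-1},s)^2] finite for each s in the support; without such a condition, completeness for square-integrable functions only does not suffice and the claim fails. *)

theory Defs
  imports "HOL-Probability.Probability"
begin

text \<open>
  The sets of states, measurements and latent states are the carriers of sigma-finite reference
  measures \<open>refS\<close>, \<open>refW\<close>, \<open>refU\<close> (Lebesgue measure on a Borel subset of a Euclidean space for
  continuous variables, where \<open>dw\<close> is integration against \<open>refW\<close>); the finite set of actions is
  a finite type with counting measure.

  Conditioning on \<open>S t = s\<close> or on \<open>U (t - 1) = u\<close> is conditioning on a null event in the continuous
  case, and the theorem speaks about every single \<open>s\<close> in the support.  The value at \<open>s\<close> of a
  conditional density is only meaningful relative to a fixed version of the joint density, so the
  joint densities are part of the data of a model and all marginal and conditional densities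
  are computed from them:
  \<open>dens X t\<close> is the joint density of \<open>(S (t-1), S t, W (t-1), U (t-1), A t)\<close>, and
  \<open>dens_pot X t x\<close> that of the same tuple extended by the potential action under \<open>do(S t = x)\<close>.
\<close>

record ('m, 's, 'w, 'u, 'a) imitation =
  Om :: "'m measure"
  refS :: "'s measure"
  refW :: "'w measure"
  refU :: "'u measure"
  st :: "nat \<Rightarrow> 'm \<Rightarrow> 's"
  meas :: "nat \<Rightarrow> 'm \<Rightarrow> 'w"
  lat :: "nat \<Rightarrow> 'm \<Rightarrow> 'u"
  act :: "nat \<Rightarrow> 'm \<Rightarrow> 'a"
  pot :: "nat \<Rightarrow> 's \<Rightarrow> 'm \<Rightarrow> 'a"
  dens :: "nat \<Rightarrow> 's \<times> 's \<times> 'w \<times> 'u \<times> 'a \<Rightarrow> real"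
  dens_pot :: "nat \<Rightarrow> 's \<Rightarrow> 's \<times> 's \<times> 'w \<times> 'u \<times> 'a \<times> 'a \<Rightarrow> real"

abbreviation actions :: "'a measure" where
  "actions \<equiv> count_space UNIV"


subsection \<open>Observed densities\<close>

text \<open>
  The functions of this subsection take only the observed joint density \<open>p\<close> of
  \<open>(S (t-1), S t, W (t-1), A t)\<close>.  Conditional densities are quotients; where the density of the
  condition vanishes they are 0 by \<open>x / 0 = 0\<close>.
\<close>

definition obs :: "('m, 's, 'w, 'u, 'a) imitation \<Rightarrow> nat \<Rightarrow> 's \<times> 's \<times> 'w \<times> 'a \<Rightarrow> real" where
  "obs X t = (\<lambda>(z, s, w, a). \<integral>u. dens X t (z, s, w, u, a) \<partial>refU X)"

definition obs_space :: "'s measure \<Rightarrow> 'w measure \<Rightarrow> ('s \<times> 's \<times> 'w \<times> 'a) measure" where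
  "obs_space RS RW = RS \<Otimes>\<^sub>M RS \<Otimes>\<^sub>M RW \<Otimes>\<^sub>M actions"

definition obs_var :: "('m, 's, 'w, 'u, 'a) imitation \<Rightarrow> nat \<Rightarrow> 'm \<Rightarrow> 's \<times> 's \<times> 'w \<times> 'a" where
  "obs_var X t = (\<lambda>\<omega>. (st X (t - 1) \<omega>, st X t \<omega>, meas X (t - 1) \<omega>, act X t \<omega>))"

definition p_prev :: "'s measure \<Rightarrow> 'w measure \<Rightarrow> ('s \<times> 's \<times> 'w \<times> 'a \<Rightarrow> real) \<Rightarrow> 's \<Rightarrow> real" where
  "p_prev RS RW p z = (\<integral>(s, w, a). p (z, s, w, a) \<partial>(RS \<Otimes>\<^sub>M RW \<Otimes>\<^sub>M actions))"

definition p_cur :: "'s measure \<Rightarrow> 'w measure \<Rightarrow> ('s \<times> 's \<times> 'w \<times> 'a \<Rightarrow> real) \<Rightarrow> 's \<Rightarrow> real" where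
  "p_cur RS RW p s = (\<integral>(z, w, a). p (z, s, w, a) \<partial>(RS \<Otimes>\<^sub>M RW \<Otimes>\<^sub>M actions))"

definition p_meas :: "'s measure \<Rightarrow> ('s \<times> 's \<times> 'w \<times> 'a \<Rightarrow> real) \<Rightarrow> 'w \<Rightarrow> real" where
  "p_meas RS p w = (\<integral>(z, s, a). p (z, s, w, a) \<partial>(RS \<Otimes>\<^sub>M RS \<Otimes>\<^sub>M actions))"

definition p_pair :: "'w measure \<Rightarrow> ('s \<times> 's \<times> 'w \<times> 'a \<Rightarrow> real) \<Rightarrow> 's \<Rightarrow> 's \<Rightarrow> real" where
  "p_pair RW p z s = (\<integral>(w, a). p (z, s, w, a) \<partial>(RW \<Otimes>\<^sub>M actions))"

definition p_act_given :: "'w measure \<Rightarrow> ('s \<times> 's \<times> 'w \<times> 'a \<Rightarrow> real) \<Rightarrow> 'a \<Rightarrow> 's \<Rightarrow> 's \<Rightarrow> real" where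
  "p_act_given RW p a z s = (\<integral>w. p (z, s, w, a) \<partial>RW) / p_pair RW p z s"

definition p_meas_given ::
  "'w measure \<Rightarrow> ('s \<times> 's \<times> 'w \<times> 'a::finite \<Rightarrow> real) \<Rightarrow> 'w \<Rightarrow> 's \<Rightarrow> 's \<Rightarrow> real" where
  "p_meas_given RW p w z s = (\<Sum>a\<in>UNIV. p (z, s, w, a)) / p_pair RW p z s"

definition supp_prev :: "'s measure \<Rightarrow> 'w measure \<Rightarrow> ('s \<times> 's \<times> 'w \<times> 'a \<Rightarrow> real) \<Rightarrow> 's set" where
  "supp_prev RS RW p = {z \<in> space RS. 0 < p_prev RS RW p z}"

definition supp_cur :: "'s measure \<Rightarrow> 'w measure \<Rightarrow> ('s \<times> 's \<times> 'w \<times> 'a \<Rightarrow> real) \<Rightarrow> 's set" where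
  "supp_cur RS RW p = {s \<in> space RS. 0 < p_cur RS RW p s}"

text \<open>
  A bridge function for the action \<open>a\<close>.  Square integrability of \<open>h(W (t-1), s)\<close> makes
  \<open>E[h(W (t-1), s) | U (t-1)]\<close> a square-integrable function of \<open>U (t-1)\<close>, i.e. a function to which
  completeness, which is about square-integrable functions only, applies; it also makes the integral
  of \<open>h(w, s) p(w)\<close> exist.
\<close>

definition bridge ::
  "'s measure \<Rightarrow> 'w measure \<Rightarrow> ('s \<times> 's \<times> 'w \<times> 'a::finite \<Rightarrow> real) \<Rightarrow> 'a \<Rightarrow> ('w \<Rightarrow> 's \<Rightarrow> real) \<Rightarrow> bool"
where
  "bridge RS RW p a h \<longleftrightarrow>
    (\<forall>s\<in>supp_cur RS RW p.
       (\<lambda>w. h w s) \<in> borel_measurable RW \<and>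
       integrable RW (\<lambda>w. (h w s)\<^sup>2 * p_meas RS p w) \<and>
       (\<forall>z\<in>supp_prev RS RW p.
          integrable RW (\<lambda>w. h w s * p_meas_given RW p w z s) \<and>
          p_act_given RW p a z s = (\<integral>w. h w s * p_meas_given RW p w z s \<partial>RW)))"


subsection \<open>Densities involving the latent state\<close>

abbreviation cur_support :: "('m, 's, 'w, 'u, 'a) imitation \<Rightarrow> nat \<Rightarrow> 's set" where
  "cur_support X t \<equiv> supp_cur (refS X) (refW X) (obs X t)"

definition p_lat :: "('m, 's, 'w, 'u, 'a) imitation \<Rightarrow> nat \<Rightarrow> 'u \<Rightarrow> real" where
  "p_lat X t u =
    (\<integral>(z, s, w, a). dens X t (z, s, w, u, a) \<partial>(refS X \<Otimes>\<^sub>M refS X \<Otimes>\<^sub>M refW X \<Otimes>\<^sub>M actions))"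

definition p_cur_given_lat :: "('m, 's, 'w, 'u, 'a) imitation \<Rightarrow> nat \<Rightarrow> 's \<Rightarrow> 'u \<Rightarrow> real" where
  "p_cur_given_lat X t s u =
    (\<integral>(z, w, a). dens X t (z, s, w, u, a) \<partial>(refS X \<Otimes>\<^sub>M refW X \<Otimes>\<^sub>M actions)) / p_lat X t u"

definition p_lat_given :: "('m, 's, 'w, 'u, 'a) imitation \<Rightarrow> nat \<Rightarrow> 'u \<Rightarrow> 's \<Rightarrow> 's \<Rightarrow> real" where
  "p_lat_given X t u z s =
    (\<integral>(w, a). dens X t (z, s, w, u, a) \<partial>(refW X \<Otimes>\<^sub>M actions)) / p_pair (refW X) (obs X t) z s"

text \<open>
  Conditional independence of two variables given a third one, for the joint density \<open>q\<close> of the three: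
  \<open>p(x, y | c) = p(x | c) p(y | c)\<close> whenever \<open>p(c) > 0\<close>.
\<close>

definition cond_indep_density ::
  "'x measure \<Rightarrow> 'y measure \<Rightarrow> 'c measure \<Rightarrow> ('x \<Rightarrow> 'y \<Rightarrow> 'c \<Rightarrow> real) \<Rightarrow> bool" where
  "cond_indep_density MX MY MC q \<longleftrightarrow>
    (\<forall>x\<in>space MX. \<forall>y\<in>space MY. \<forall>c\<in>space MC.
       let pc = (\<integral>(x', y'). q x' y' c \<partial>(MX \<Otimes>\<^sub>M MY)) in
       0 < pc \<longrightarrow>
       q x y c / pc = ((\<integral>y'. q x y' c \<partial>MY) / pc) * ((\<integral>x'. q x' y c \<partial>MX) / pc))"


subsection \<open>Models and the causal assumptions\<close>

text \<open>
  The last two conditions on \<open>dens\<close> only concern the choice of the version (any joint density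
  satisfies them after modification on a null set): \<open>p(s)\<close> is finite for every \<open>s\<close>, and the joint
  density vanishes where \<open>p(u)\<close> does, so that \<open>p(z, s, w, u, a) = p(z, s, w, a | u) p(u)\<close> holds
  everywhere.  Similarly, the densities with the potential action have \<open>dens\<close> as their marginal
  everywhere, not just almost everywhere.
\<close>

definition wf_model :: "nat \<Rightarrow> ('m, 's, 'w, 'u, 'a::finite) imitation \<Rightarrow> bool" where
  "wf_model T X \<longleftrightarrow>
    prob_space (Om X) \<and>
    sigma_finite_measure (refS X) \<and> sigma_finite_measure (refW X) \<and> sigma_finite_measure (refU X) \<and>
    (\<forall>t\<in>{1..T}.
       (\<forall>y. 0 \<le> dens X t y) \<and>
       distributed (Om X) (refS X \<Otimes>\<^sub>M refS X \<Otimes>\<^sub>M refW X \<Otimes>\<^sub>M refU X \<Otimes>\<^sub>M actions)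
         (\<lambda>\<omega>. (st X (t - 1) \<omega>, st X t \<omega>, meas X (t - 1) \<omega>, lat X (t - 1) \<omega>, act X t \<omega>))
         (\<lambda>y. ennreal (dens X t y)) \<and>
       (\<forall>x\<in>space (refS X).
          (\<forall>y. 0 \<le> dens_pot X t x y) \<and>
          distributed (Om X)
            (refS X \<Otimes>\<^sub>M refS X \<Otimes>\<^sub>M refW X \<Otimes>\<^sub>M refU X \<Otimes>\<^sub>M actions \<Otimes>\<^sub>M actions)
            (\<lambda>\<omega>. (st X (t - 1) \<omega>, st X t \<omega>, meas X (t - 1) \<omega>, lat X (t - 1) \<omega>, act X t \<omega>,
                   pot X t x \<omega>))
            (\<lambda>y. ennreal (dens_pot X t x y)) \<and>
          (\<forall>z s w u a. dens X t (z, s, w, u, a) =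
             (\<Sum>b\<in>UNIV. dens_pot X t x (z, s, w, u, a, b)))) \<and>
       (\<forall>s\<in>space (refS X).
          integrable (refS X \<Otimes>\<^sub>M refW X \<Otimes>\<^sub>M refU X \<Otimes>\<^sub>M actions)
            (\<lambda>(z, w, u, a). dens X t (z, s, w, u, a))) \<and>
       (\<forall>z s w u a. p_lat X t u = 0 \<longrightarrow> dens X t (z, s, w, u, a) = 0))"

definition proxy_independence :: "('m, 's, 'w, 'u, 'a::finite) imitation \<Rightarrow> nat \<Rightarrow> bool" where
  "proxy_independence X t \<longleftrightarrow>
    cond_indep_density (refS X) actions (refS X \<Otimes>\<^sub>M refU X)
      (\<lambda>z a (s, u). \<integral>w. dens X t (z, s, w, u, a) \<partial>refW X) \<and>
    cond_indep_density (refS X \<Otimes>\<^sub>M refS X) (refW X) (refU X)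
      (\<lambda>(z, s) w u. \<Sum>a\<in>UNIV. dens X t (z, s, w, u, a))"

text \<open>
  Consistency reads \<open>P(A t = A t^(s) | S t = s) = 1\<close>.  The unconditional statement that
  \<open>A t = A t^(s)\<close> almost surely on the event \<open>S t = s\<close> would be void when this event is null.
\<close>

definition consistency :: "('m, 's, 'w, 'u, 'a::finite) imitation \<Rightarrow> nat \<Rightarrow> bool" where
  "consistency X t \<longleftrightarrow>
    (\<forall>s\<in>cur_support X t.
       (\<Sum>a\<in>UNIV. \<integral>(z, w, u). dens_pot X t s (z, s, w, u, a, a) \<partial>(refS X \<Otimes>\<^sub>M refW X \<Otimes>\<^sub>M refU X))
         / p_cur (refS X) (refW X) (obs X t) s = 1)"

definition positivity :: "('m, 's, 'w, 'u, 'a) imitation \<Rightarrow> nat \<Rightarrow> bool" where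
  "positivity X t \<longleftrightarrow>
    (\<forall>u\<in>{u \<in> space (refU X). 0 < p_lat X t u}. \<forall>s\<in>cur_support X t. 0 < p_cur_given_lat X t s u)"

definition latent_exchangeability :: "('m, 's, 'w, 'u, 'a) imitation \<Rightarrow> nat \<Rightarrow> bool" where
  "latent_exchangeability X t \<longleftrightarrow>
    (\<forall>x\<in>space (refS X).
       cond_indep_density actions (refS X) (refU X)
         (\<lambda>b s u. \<integral>(z, w, a). dens_pot X t x (z, s, w, u, a, b) \<partial>(refS X \<Otimes>\<^sub>M refW X \<Otimes>\<^sub>M actions)))"

text \<open>
  \<open>E[\<nu>(U (t-1)) | S (t-1) = z, S t = s]\<close> is the integral of \<open>\<nu>(u) p(u | z, s)\<close>; the premise asks it to
  exist and to vanish at almost every value \<open>z\<close> of \<open>S (t-1)\<close>.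
\<close>

definition completeness :: "('m, 's, 'w, 'u, 'a) imitation \<Rightarrow> nat \<Rightarrow> bool" where
  "completeness X t \<longleftrightarrow>
    (\<forall>s\<in>cur_support X t. \<forall>\<nu>\<in>borel_measurable (refU X).
       integrable (Om X) (\<lambda>\<omega>. (\<nu> (lat X (t - 1) \<omega>))\<^sup>2) \<longrightarrow>
       (AE \<omega> in Om X.
          integrable (refU X) (\<lambda>u. \<nu> u * p_lat_given X t u (st X (t - 1) \<omega>) s) \<and>
          (\<integral>u. \<nu> u * p_lat_given X t u (st X (t - 1) \<omega>) s \<partial>refU X) = (0::real)) \<longrightarrow>
       (AE \<omega> in Om X. \<nu> (lat X (t - 1) \<omega>) = 0))"

definition bridge_existence :: "('m, 's, 'w, 'u, 'a::finite) imitation \<Rightarrow> nat \<Rightarrow> bool" where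
  "bridge_existence X t \<longleftrightarrow> (\<forall>a. \<exists>h. bridge (refS X) (refW X) (obs X t) a h)"

definition imitation_model :: "nat \<Rightarrow> ('m, 's, 'w, 'u, 'a::finite) imitation \<Rightarrow> bool" where
  "imitation_model T X \<longleftrightarrow>
    wf_model T X \<and>
    (\<forall>t\<in>{1..T}. proxy_independence X t \<and> consistency X t \<and> positivity X t \<and>
       latent_exchangeability X t \<and> completeness X t \<and> bridge_existence X t)"


subsection \<open>The causal imitation target\<close>

definition pot_prob :: "('m, 's, 'w, 'u, 'a) imitation \<Rightarrow> nat \<Rightarrow> 's \<Rightarrow> 'a \<Rightarrow> real" where
  "pot_prob X t s a = measure (Om X) {\<omega> \<in> space (Om X). pot X t s \<omega> = a}"

text \<open>The possible values of \<open>\<pi>\<^sub>o\<^sub>p\<^sub>t(s)\<close>; there are several in case of ties.\<close>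

definition opt_actions :: "('m, 's, 'w, 'u, 'a) imitation \<Rightarrow> nat \<Rightarrow> 's \<Rightarrow> 'a set" where
  "opt_actions X t s = {a. is_arg_max (pot_prob X t s) (\<lambda>_. True) a}"

end

(* Write g(u) = p(A = a | S = s, U = u) and k(u) = E[h(W, s) | U = u].  The two proxy independences
   give p(a | z, s) = E[g(U) | z, s] and E[h(W, s) | z, s] = E[k(U) | z, s], so the bridge equation
   says that E[(g - k)(U) | z, s] = 0.  Square integrability of h(W, s) passes to k(U) by Jensen's
   inequality, hence completeness yields g(U) = k(U) almost surely.  Consistency and latent
   exchangeability give P(A^(s) = a) = E[g(U)], which equals E[k(U)] = E[h(W, s)].

   Completeness looks at almost every z only, so the bridge equation is used only at almost every z.
   This weaker form does not depend on the version of the observed density, for almost every s;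
   this yields identification from the distribution of the observed variables. *)

theory Submission
  imports Defs
begin

text \<open>Two default values threaten every identity: a divergent Bochner integral is 0, and
  \<open>x / 0 = 0\<close>. The calculations therefore run in nonnegative integrals, where Fubini
  asks for no integrability, and \<open>ennreal_lebesgue_integral\<close> returns to the Bochner
  integrals of the definitions once a value is nonzero or the integral is known to be finite. The
  claim concerns one fixed s, so null sets may be discarded in z, w and u, but not at s itself. What
  replaces them there is the finiteness of p(s) in \<open>wf_model\<close>, positivity, which makes
  p(s, u) nonzero and hence a true integral, and the factorisations, which hold at every point where
  the density of the condition is positive. The equality P(A^(s) = a) = E[g(U)] splits in two.
  Exchangeability gives p(b | u) = p(b | s, u) for the potential action b. Consistency makes the
  matrix of the densities of (A, A^(s)) at S = s diagonal for almost every u, so the potential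
  action can be replaced by the observed one. Square integrability of g - k rests on 0 \<le> g \<le>
  1 in addition to Jensen's inequality.\<close>

subsection \<open>Iterated integrals over a finite last factor\<close>

lemma nn_integral_pair_finite:
  fixes f :: "'x \<times> 'a::finite \<Rightarrow> ennreal"
  assumes "f \<in> borel_measurable (M \<Otimes>\<^sub>M actions)"
  shows "(\<integral>\<^sup>+y. f y \<partial>(M \<Otimes>\<^sub>M actions)) = (\<integral>\<^sup>+x. (\<Sum>a\<in>UNIV. f (x, a)) \<partial>M)"
proof -
  interpret a: sigma_finite_measure "count_space (UNIV :: 'a set)"
    by (rule sigma_finite_measure_count_space_finite) simp
  show ?thesis
    unfolding a.nn_integral_fst[OF assms, symmetric] by (simp add: nn_integral_count_space_finite)
qed

lemma nn_integral_triple_finite: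
  fixes f :: "'x \<times> 'y \<times> 'a::finite \<Rightarrow> ennreal"
  assumes "sigma_finite_measure N" and [measurable]: "f \<in> borel_measurable (M \<Otimes>\<^sub>M N \<Otimes>\<^sub>M actions)"
  shows "(\<integral>\<^sup>+y. f y \<partial>(M \<Otimes>\<^sub>M N \<Otimes>\<^sub>M actions)) = (\<integral>\<^sup>+x. \<integral>\<^sup>+y. (\<Sum>a\<in>UNIV. f (x, y, a)) \<partial>N \<partial>M)"
proof -
  interpret N: sigma_finite_measure N by fact
  interpret a: sigma_finite_measure "count_space (UNIV :: 'a set)"
    by (rule sigma_finite_measure_count_space_finite) simp
  interpret pair_sigma_finite N "count_space (UNIV :: 'a set)" ..
  show ?thesis
    by (subst nn_integral_fst[symmetric]) (auto intro!: nn_integral_cong nn_integral_pair_finite)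
qed

lemma nn_integral_quad_finite:
  fixes f :: "'x \<times> 'y \<times> 'z \<times> 'a::finite \<Rightarrow> ennreal"
  assumes "sigma_finite_measure N" "sigma_finite_measure K"
    and [measurable]: "f \<in> borel_measurable (M \<Otimes>\<^sub>M N \<Otimes>\<^sub>M K \<Otimes>\<^sub>M actions)"
  shows "(\<integral>\<^sup>+y. f y \<partial>(M \<Otimes>\<^sub>M N \<Otimes>\<^sub>M K \<Otimes>\<^sub>M actions)) =
    (\<integral>\<^sup>+x. \<integral>\<^sup>+y. \<integral>\<^sup>+z. (\<Sum>a\<in>UNIV. f (x, y, z, a)) \<partial>K \<partial>N \<partial>M)"
proof -
  interpret N: sigma_finite_measure N by fact
  interpret K: sigma_finite_measure K by fact
  interpret a: sigma_finite_measure "count_space (UNIV :: 'a set)"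
    by (rule sigma_finite_measure_count_space_finite) simp
  interpret Ka: pair_sigma_finite K "count_space (UNIV :: 'a set)" ..
  interpret pair_sigma_finite N "K \<Otimes>\<^sub>M count_space (UNIV :: 'a set)" ..
  show ?thesis
    by (subst nn_integral_fst[symmetric])
      (auto intro!: nn_integral_cong nn_integral_triple_finite assms(2))
qed

text \<open>Serves the comparison of two models. The quantifiers stay nested, in the order of the
  integrals, because the sections at a fixed first variable are what is needed later.\<close>

lemma nn_integral_triple_0_AE:
  assumes "sigma_finite_measure N" "sigma_finite_measure K"
    and [measurable]: "(\<lambda>(x, y, z). f x y z) \<in> borel_measurable (M \<Otimes>\<^sub>M N \<Otimes>\<^sub>M K)"
    and 0: "(\<integral>\<^sup>+x. \<integral>\<^sup>+y. \<integral>\<^sup>+z. f x y z \<partial>K \<partial>N \<partial>M) = 0"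
  shows "AE x in M. AE y in N. AE z in K. f x y z = (0::ennreal)"
proof -
  interpret N: sigma_finite_measure N by fact
  interpret K: sigma_finite_measure K by fact
  have "(\<lambda>x. \<integral>\<^sup>+y. \<integral>\<^sup>+z. (case (x, y, z) of (x, y, z) \<Rightarrow> f x y z) \<partial>K \<partial>N) \<in> borel_measurable M"
    by measurable
  then have "AE x in M. (\<integral>\<^sup>+y. \<integral>\<^sup>+z. f x y z \<partial>K \<partial>N) = 0"
    using 0 by (subst nn_integral_0_iff_AE[symmetric]) simp_all
  then show ?thesis using AE_space
  proof eventually_elim
    case (elim x)
    then have [measurable]: "(\<lambda>(y, z). f x y z) \<in> borel_measurable (N \<Otimes>\<^sub>M K)"
      using measurable_compose_Pair1[OF elim(2) assms(3)] by simp
    have "AE y in N. (\<integral>\<^sup>+z. f x y z \<partial>K) = 0"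
      using elim by (subst nn_integral_0_iff_AE[symmetric]) simp_all
    then show ?case using AE_space
    proof eventually_elim
      case (elim y)
      then have "(\<lambda>z. f x y z) \<in> borel_measurable K"
        using measurable_compose_Pair1[of y N "\<lambda>(y, z). f x y z" K] by simp
      with elim show ?case
        by (subst nn_integral_0_iff_AE[symmetric]) simp_all
    qed
  qed
qed

lemma AE_nn_integral_finite:
  assumes "f \<in> borel_measurable M" "(\<integral>\<^sup>+x. f x \<partial>M) < \<infinity>"
  shows "AE x in M. f x < \<infinity>"
  using nn_integral_PInf_AE[of f M] assms by (auto simp: less_top)

text \<open>Lets the law of a single variable be read off from \<open>nn_expectation\<close>, taken
  at an indicator function.\<close>

lemma distributedI_nn_integral:
  assumes "X \<in> measurable M N" "f \<in> borel_measurable N"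
    and eq: "\<And>A. A \<in> sets N \<Longrightarrow> (\<integral>\<^sup>+\<omega>. indicator A (X \<omega>) \<partial>M) = (\<integral>\<^sup>+x. f x * indicator A x \<partial>N)"
  shows "distributed M N X f"
  unfolding distributed_def
proof (intro conjI measure_eqI)
  fix A assume "A \<in> sets (distr M N X)"
  then have A: "A \<in> sets N" by simp
  have "emeasure (distr M N X) A = (\<integral>\<^sup>+x. indicator A x \<partial>distr M N X)"
    using A by simp
  also have "\<dots> = (\<integral>\<^sup>+\<omega>. indicator A (X \<omega>) \<partial>M)"
    using A assms(1) by (intro nn_integral_distr) simp_all
  also have "\<dots> = emeasure (density N f) A"
    using A assms(2) by (simp add: eq emeasure_density)
  finally show "emeasure (distr M N X) A = emeasure (density N f) A" .
qed (use assms in simp_all)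

text \<open>A function that is not integrable has Bochner integral 0. Hence a nonzero value
  certifies integrability just as well as a finite nonnegative integral does.\<close>

lemma ennreal_lebesgue_integral:
  fixes f :: "'x \<Rightarrow> real"
  assumes [measurable]: "f \<in> borel_measurable M" and nn: "\<And>x. 0 \<le> f x"
    and "(\<integral>\<^sup>+x. f x \<partial>M) < \<infinity> \<or> (\<integral>x. f x \<partial>M) \<noteq> 0"
  shows "ennreal (\<integral>x. f x \<partial>M) = (\<integral>\<^sup>+x. f x \<partial>M)"
proof -
  have "integrable M f"
    using assms not_integrable_integral_eq[of M f] by (auto simp: integrable_iff_bounded)
  then show ?thesis
    by (simp add: nn nn_integral_eq_integral)
qed

text \<open>Integrability of h from that of its square, against a density of finite mass.\<close>

lemma abs_le_one_plus_square: "\<bar>x\<bar> \<le> 1 + x\<^sup>2" for x :: real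
proof -
  have "0 \<le> (\<bar>x\<bar> - 1)\<^sup>2" by simp
  then show ?thesis by (simp add: power2_diff)
qed

lemma integral_triple_finite:
  fixes f :: "'x \<times> 'y \<times> 'a::finite \<Rightarrow> real"
  assumes "sigma_finite_measure N" and [measurable]: "f \<in> borel_measurable (M \<Otimes>\<^sub>M N \<Otimes>\<^sub>M actions)"
    and "\<And>y. 0 \<le> f y"
  shows "(\<integral>y. f y \<partial>(M \<Otimes>\<^sub>M N \<Otimes>\<^sub>M actions)) = enn2real (\<integral>\<^sup>+x. \<integral>\<^sup>+y. (\<Sum>a\<in>UNIV. f (x, y, a)) \<partial>N \<partial>M)"
  using assms by (subst integral_eq_nn_integral) (simp_all add: nn_integral_triple_finite)

text \<open>Divergence is harmless here: both sides are \<open>enn2real\<close> of equal nonnegative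
  integrals. The nested form of the last assumption fits sections of the observed densities at a
  fixed variable.\<close>

lemma integral_triple_finite_cong_AE:
  fixes f g :: "'x \<times> 'y \<times> 'a::finite \<Rightarrow> real"
  assumes N: "sigma_finite_measure N"
    and "f \<in> borel_measurable (M \<Otimes>\<^sub>M N \<Otimes>\<^sub>M actions)" "g \<in> borel_measurable (M \<Otimes>\<^sub>M N \<Otimes>\<^sub>M actions)"
    and "\<And>y. 0 \<le> f y" "\<And>y. 0 \<le> g y"
    and AE: "AE x in M. AE y in N. \<forall>a. f (x, y, a) = g (x, y, a)"
  shows "(\<integral>y. f y \<partial>(M \<Otimes>\<^sub>M N \<Otimes>\<^sub>M actions)) = (\<integral>y. g y \<partial>(M \<Otimes>\<^sub>M N \<Otimes>\<^sub>M actions))"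
proof -
  have "(\<integral>\<^sup>+x. \<integral>\<^sup>+y. (\<Sum>a\<in>UNIV. f (x, y, a)) \<partial>N \<partial>M) = (\<integral>\<^sup>+x. \<integral>\<^sup>+y. (\<Sum>a\<in>UNIV. g (x, y, a)) \<partial>N \<partial>M)"
    using AE by (intro nn_integral_cong_AE) (auto elim!: eventually_mono intro!: nn_integral_cong_AE)
  then show ?thesis
    using assms by (simp add: integral_triple_finite)
qed

lemma integral_pair_finite_cong_AE:
  fixes f g :: "'x \<times> 'a::finite \<Rightarrow> real"
  assumes "f \<in> borel_measurable (M \<Otimes>\<^sub>M actions)" "g \<in> borel_measurable (M \<Otimes>\<^sub>M actions)"
    and "\<And>y. 0 \<le> f y" "\<And>y. 0 \<le> g y"
    and AE: "AE x in M. \<forall>a. f (x, a) = g (x, a)"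
  shows "(\<integral>y. f y \<partial>(M \<Otimes>\<^sub>M actions)) = (\<integral>y. g y \<partial>(M \<Otimes>\<^sub>M actions))"
proof -
  have "(\<integral>\<^sup>+x. (\<Sum>a\<in>UNIV. f (x, a)) \<partial>M) = (\<integral>\<^sup>+x. (\<Sum>a\<in>UNIV. g (x, a)) \<partial>M)"
    using AE by (intro nn_integral_cong_AE) (auto elim!: eventually_mono)
  then show ?thesis
    using assms by (simp add: integral_eq_nn_integral nn_integral_pair_finite)
qed

subsection \<open>A model at a fixed time\<close>

locale imitation_at =
  fixes X :: "('m, 's, 'w, 'u, 'a::finite) imitation" and T t :: nat
  assumes model: "imitation_model T X" and t: "t \<in> {1..T}"
begin

abbreviation "RS \<equiv> refS X"
abbreviation "RW \<equiv> refW X"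
abbreviation "RU \<equiv> refU X"
abbreviation "d z s w u a \<equiv> dens X t (z, s, w, u, a)"
abbreviation "dp x z s w u a b \<equiv> dens_pot X t x (z, s, w, u, a, b)"
abbreviation "PU \<equiv> p_lat X t"
abbreviation "p \<equiv> obs X t"

section \<open>Unpacking the model and the integral formulas for its expectations\<close>

lemma wf: "wf_model T X" and proxy: "proxy_independence X t" and consistent: "consistency X t"
  and pos: "positivity X t" and exch: "latent_exchangeability X t" and complete: "completeness X t"
  and bridge_ex: "bridge_existence X t"
  using model t unfolding imitation_model_def by blast+

sublocale prob_space "Om X" using wf unfolding wf_model_def by blast
sublocale RS: sigma_finite_measure RS using wf unfolding wf_model_def by blast
sublocale RW: sigma_finite_measure RW using wf unfolding wf_model_def by blast
sublocale RU: sigma_finite_measure RU using wf unfolding wf_model_def by blast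
text \<open>Named, because Fubini and the splitting of products are called on specific pairs of
  factors. Each instance also makes its product sigma-finite, which longer products rely on.\<close>

sublocale SS: pair_sigma_finite RS RS ..
sublocale SW: pair_sigma_finite RS RW ..
sublocale SU: pair_sigma_finite RS RU ..
sublocale WU: pair_sigma_finite RW RU ..
sublocale A: sigma_finite_measure "actions :: 'a measure"
  by (rule sigma_finite_measure_count_space_finite) simp
sublocale AA: pair_sigma_finite "actions :: 'a measure" "actions :: 'a measure" ..
sublocale SA: pair_sigma_finite RS "actions :: 'a measure" ..
sublocale WA: pair_sigma_finite RW "actions :: 'a measure" ..
sublocale UA: pair_sigma_finite RU "actions :: 'a measure" ..
sublocale SSA: pair_sigma_finite RS "RS \<Otimes>\<^sub>M (actions :: 'a measure)" ..
sublocale SWA: pair_sigma_finite RS "RW \<Otimes>\<^sub>M (actions :: 'a measure)" ..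
sublocale SSWA: pair_sigma_finite RS "RS \<Otimes>\<^sub>M RW \<Otimes>\<^sub>M (actions :: 'a measure)" ..
sublocale WUA: pair_sigma_finite RW "RU \<Otimes>\<^sub>M (actions :: 'a measure)" ..
sublocale SWUA: pair_sigma_finite RS "RW \<Otimes>\<^sub>M RU \<Otimes>\<^sub>M (actions :: 'a measure)" ..
sublocale UAA: pair_sigma_finite RU "(actions :: 'a measure) \<Otimes>\<^sub>M (actions :: 'a measure)" ..
sublocale WUAA: pair_sigma_finite RW "RU \<Otimes>\<^sub>M (actions :: 'a measure) \<Otimes>\<^sub>M (actions :: 'a measure)" ..
sublocale SWUAA: pair_sigma_finite RS
  "RW \<Otimes>\<^sub>M RU \<Otimes>\<^sub>M (actions :: 'a measure) \<Otimes>\<^sub>M (actions :: 'a measure)" ..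

lemmas sigma_finite = RS.sigma_finite_measure_axioms RW.sigma_finite_measure_axioms
  RU.sigma_finite_measure_axioms A.sigma_finite_measure_axioms

lemma dens_nonneg[simp]: "0 \<le> dens X t y"
  and dist: "distributed (Om X) (RS \<Otimes>\<^sub>M RS \<Otimes>\<^sub>M RW \<Otimes>\<^sub>M RU \<Otimes>\<^sub>M actions)
         (\<lambda>\<omega>. (st X (t - 1) \<omega>, st X t \<omega>, meas X (t - 1) \<omega>, lat X (t - 1) \<omega>, act X t \<omega>))
         (\<lambda>y. ennreal (dens X t y))"
  and dens_integrable: "s \<in> space RS \<Longrightarrow>
    integrable (RS \<Otimes>\<^sub>M RW \<Otimes>\<^sub>M RU \<Otimes>\<^sub>M actions) (\<lambda>(z, w, u, a). d z s w u a)"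
  and dens_zero: "PU u = 0 \<Longrightarrow> d z s w u a = 0"
  using wf t unfolding wf_model_def by blast+

lemma dens_pot_nonneg[simp]: "x \<in> space RS \<Longrightarrow> 0 \<le> dens_pot X t x y"
  and dist_pot: "x \<in> space RS \<Longrightarrow> distributed (Om X)
            (RS \<Otimes>\<^sub>M RS \<Otimes>\<^sub>M RW \<Otimes>\<^sub>M RU \<Otimes>\<^sub>M actions \<Otimes>\<^sub>M actions)
            (\<lambda>\<omega>. (st X (t - 1) \<omega>, st X t \<omega>, meas X (t - 1) \<omega>, lat X (t - 1) \<omega>, act X t \<omega>,
                   pot X t x \<omega>))
            (\<lambda>y. ennreal (dens_pot X t x y))"
  and dens_eq_sum_pot: "x \<in> space RS \<Longrightarrow> d z s w u a = (\<Sum>b\<in>UNIV. dp x z s w u a b)"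
  using wf t unfolding wf_model_def by blast+

lemma dens_measurable[measurable]:
  "dens X t \<in> borel_measurable (RS \<Otimes>\<^sub>M RS \<Otimes>\<^sub>M RW \<Otimes>\<^sub>M RU \<Otimes>\<^sub>M actions)"
  using distributed_real_measurable[OF _ dist] by simp

lemma dens_pot_measurable[measurable (raw)]:
  "x \<in> space RS \<Longrightarrow>
    dens_pot X t x \<in> borel_measurable (RS \<Otimes>\<^sub>M RS \<Otimes>\<^sub>M RW \<Otimes>\<^sub>M RU \<Otimes>\<^sub>M actions \<Otimes>\<^sub>M actions)"
  using distributed_real_measurable[OF _ dist_pot] by simp

lemma
  shows st_prev_measurable[measurable]: "st X (t - 1) \<in> measurable (Om X) RS"
  and st_measurable[measurable]: "st X t \<in> measurable (Om X) RS"
  and meas_measurable[measurable]: "meas X (t - 1) \<in> measurable (Om X) RW"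
  and lat_measurable[measurable]: "lat X (t - 1) \<in> measurable (Om X) RU"
  and act_measurable[measurable]: "act X t \<in> measurable (Om X) actions"
  using distributed_measurable[OF dist]
  by (auto simp: measurable_pair_iff comp_def)

text \<open>The simplifier rewrites \<open>t - 1\<close> to \<open>t - Suc 0\<close>, so both forms have to be known to be measurable.\<close>

declare st_prev_measurable[unfolded One_nat_def, measurable] meas_measurable[unfolded One_nat_def, measurable]
  lat_measurable[unfolded One_nat_def, measurable]

text \<open>The source of all laws below: indicator functions are inserted for \<open>f\<close>, and
  the variables are then reordered by swapping adjacent integrals.\<close>

lemma nn_expectation:
  assumes [measurable]: "f \<in> borel_measurable (RS \<Otimes>\<^sub>M RS \<Otimes>\<^sub>M RW \<Otimes>\<^sub>M RU \<Otimes>\<^sub>M actions)"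
  shows "(\<integral>\<^sup>+\<omega>. f (st X (t - 1) \<omega>, st X t \<omega>, meas X (t - 1) \<omega>, lat X (t - 1) \<omega>, act X t \<omega>) \<partial>Om X) =
    (\<integral>\<^sup>+z. \<integral>\<^sup>+s. \<integral>\<^sup>+w. \<integral>\<^sup>+u. (\<Sum>a\<in>UNIV. ennreal (d z s w u a) * f (z, s, w, u, a)) \<partial>RU \<partial>RW \<partial>RS \<partial>RS)"
  unfolding distributed_nn_integral[OF dist assms, symmetric]
  by (subst SWUA.nn_integral_fst[symmetric])
    (auto intro!: nn_integral_cong simp: nn_integral_quad_finite sigma_finite)

lemma nn_pot_expectation:
  assumes x: "x \<in> space RS" and [measurable]: "f \<in> borel_measurable (RU \<Otimes>\<^sub>M actions)"
  shows "(\<integral>\<^sup>+\<omega>. f (lat X (t - 1) \<omega>, pot X t x \<omega>) \<partial>Om X) =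
    (\<integral>\<^sup>+z. \<integral>\<^sup>+s. \<integral>\<^sup>+w. \<integral>\<^sup>+u. (\<Sum>a\<in>UNIV. \<Sum>b\<in>UNIV. ennreal (dp x z s w u a b) * f (u, b)) \<partial>RU \<partial>RW \<partial>RS \<partial>RS)"
proof -
  let ?A = "count_space (UNIV :: 'a set)"
  note [measurable] = dens_pot_measurable[OF x]
  have *: "(\<lambda>(z, s, w, u, a, b). f (u, b)) \<in> borel_measurable (RS \<Otimes>\<^sub>M RS \<Otimes>\<^sub>M RW \<Otimes>\<^sub>M RU \<Otimes>\<^sub>M ?A \<Otimes>\<^sub>M ?A)"
    by measurable
  show ?thesis
    using distributed_nn_integral[OF dist_pot[OF x] *, symmetric]
    apply simp
    apply (subst SWUAA.nn_integral_fst[symmetric], simp)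
    apply (intro nn_integral_cong)
    apply (subst WUAA.nn_integral_fst[symmetric], simp)
    apply (intro nn_integral_cong)
    apply (simp add: nn_integral_quad_finite sigma_finite nn_integral_count_space_finite)
    done
qed

subsection \<open>Marginals of the joint density\<close>

text \<open>The suffix of a marginal lists the variables that are left, in the order of the arguments.\<close>

definition dens_zswu :: "'s \<Rightarrow> 's \<Rightarrow> 'w \<Rightarrow> 'u \<Rightarrow> real" where
  "dens_zswu z s w u = (\<Sum>a\<in>UNIV. d z s w u a)"

definition dens_zsua :: "'s \<Rightarrow> 's \<Rightarrow> 'u \<Rightarrow> 'a \<Rightarrow> real" where
  "dens_zsua z s u a = (\<integral>w. d z s w u a \<partial>RW)"

definition dens_zsu :: "'s \<Rightarrow> 's \<Rightarrow> 'u \<Rightarrow> real" where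
  "dens_zsu z s u = (\<integral>w. dens_zswu z s w u \<partial>RW)"

definition dens_wu :: "'w \<Rightarrow> 'u \<Rightarrow> real" where
  "dens_wu w u = (\<integral>(z, s). dens_zswu z s w u \<partial>(RS \<Otimes>\<^sub>M RS))"

text \<open>Written exactly as the numerator of \<open>p_cur_given_lat\<close>, so that positivity
  applies to it literally.\<close>

definition dens_su :: "'s \<Rightarrow> 'u \<Rightarrow> real" where
  "dens_su s u = (\<integral>(z, w, a). d z s w u a \<partial>(RS \<Otimes>\<^sub>M RW \<Otimes>\<^sub>M actions))"

text \<open>An iterated integral, because in this form it occurs as a factor in
  \<open>cond_indep_density\<close> for the independence of S (t-1) and A t.\<close>

definition dens_sua :: "'s \<Rightarrow> 'u \<Rightarrow> 'a \<Rightarrow> real" where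
  "dens_sua s u a = (\<integral>z. dens_zsua z s u a \<partial>RS)"

lemma [simp]: "0 \<le> dens_zswu z s w u" "0 \<le> dens_zsua z s u a" "0 \<le> dens_zsu z s u"
  "0 \<le> dens_wu w u" "0 \<le> dens_su s u" "0 \<le> dens_sua s u a" "0 \<le> PU u"
  by (auto simp: dens_zswu_def dens_zsua_def dens_zsu_def dens_wu_def dens_su_def dens_sua_def
    p_lat_def split_beta' intro!: sum_nonneg Bochner_Integration.integral_nonneg)

lemma dens_zswu_measurable[measurable (raw)]:
  assumes [measurable]: "f \<in> measurable N RS" "g \<in> measurable N RS" "h \<in> measurable N RW" "k \<in> measurable N RU"
  shows "(\<lambda>x. dens_zswu (f x) (g x) (h x) (k x)) \<in> borel_measurable N"
  unfolding dens_zswu_def by measurable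

lemma dens_zsua_measurable[measurable (raw)]:
  assumes [measurable]: "f \<in> measurable N RS" "g \<in> measurable N RS" "k \<in> measurable N RU"
  shows "(\<lambda>x. dens_zsua (f x) (g x) (k x) a) \<in> borel_measurable N"
  unfolding dens_zsua_def by measurable

lemma dens_zsu_measurable[measurable (raw)]:
  assumes [measurable]: "f \<in> measurable N RS" "g \<in> measurable N RS" "k \<in> measurable N RU"
  shows "(\<lambda>x. dens_zsu (f x) (g x) (k x)) \<in> borel_measurable N"
  unfolding dens_zsu_def by measurable

lemma dens_wu_measurable[measurable (raw)]:
  assumes [measurable]: "g \<in> measurable N RW" "k \<in> measurable N RU"
  shows "(\<lambda>x. dens_wu (g x) (k x)) \<in> borel_measurable N"
  unfolding dens_wu_def by measurable

lemma dens_su_measurable[measurable (raw)]: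
  assumes [measurable]: "g \<in> measurable N RS" "k \<in> measurable N RU"
  shows "(\<lambda>x. dens_su (g x) (k x)) \<in> borel_measurable N"
  unfolding dens_su_def by measurable

lemma dens_sua_measurable[measurable (raw)]:
  assumes [measurable]: "g \<in> measurable N RS" "k \<in> measurable N RU"
  shows "(\<lambda>x. dens_sua (g x) (k x) a) \<in> borel_measurable N"
  unfolding dens_sua_def by measurable

lemma p_lat_measurable[measurable]: "PU \<in> borel_measurable RU"
  unfolding p_lat_def[abs_def] by measurable

section \<open>The marginals as nonnegative integrals, and the law of the latent state\<close>

lemma nn_total:
  "(\<integral>\<^sup>+z. \<integral>\<^sup>+s. \<integral>\<^sup>+w. \<integral>\<^sup>+u. dens_zswu z s w u \<partial>RU \<partial>RW \<partial>RS \<partial>RS) = 1"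
  using nn_expectation[of "\<lambda>_. 1"] by (simp add: dens_zswu_def emeasure_space_1)

lemma p_lat_nn: "PU u = enn2real (\<integral>\<^sup>+z. \<integral>\<^sup>+s. \<integral>\<^sup>+w. dens_zswu z s w u \<partial>RW \<partial>RS \<partial>RS)"
  if [measurable]: "u \<in> space RU" for u
  unfolding p_lat_def
  by (subst integral_eq_nn_integral)
   (auto simp: nn_integral_quad_finite sigma_finite dens_zswu_def)

text \<open>
  A Bochner integral that diverges is 0.  For \<open>p(u)\<close> this does no harm: the density vanishes where
  \<open>p(u) = 0\<close>, so the integral cannot diverge.
\<close>

lemma ennreal_p_lat:
  assumes [measurable]: "u \<in> space RU"
  shows "ennreal (PU u) = (\<integral>\<^sup>+z. \<integral>\<^sup>+s. \<integral>\<^sup>+w. dens_zswu z s w u \<partial>RW \<partial>RS \<partial>RS)"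
proof (cases "PU u = 0")
  case True
  then show ?thesis by (simp add: dens_zero dens_zswu_def)
next
  case False
  then show ?thesis unfolding p_lat_nn[OF assms]
   by (smt (verit) enn2real_top ennreal_enn2real infinity_ennreal_def top.not_eq_extremum)
qed

text \<open>The second proxy independence, cleared of denominators. The work lies in its normalising
  constant, an integral over pairs (z, s) and w of a sum over actions, while \<open>p_lat\<close>
  integrates over a differently bracketed product that contains the actions.\<close>

lemma dens_zswu_eq:
  assumes [measurable]: "z \<in> space RS" "s \<in> space RS" "w \<in> space RW" "u \<in> space RU" and u: "0 < PU u"
  shows "dens_zswu z s w u = dens_zsu z s u * dens_wu w u / PU u"
proof -
  let ?q = "\<lambda>(z, s) w u. \<Sum>a\<in>UNIV. d z s w u a"
  have "(\<integral>(x', y'). ?q x' y' u \<partial>((RS \<Otimes>\<^sub>M RS) \<Otimes>\<^sub>M RW)) =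
      enn2real (\<integral>\<^sup>+y. ennreal (case y of (x', y') \<Rightarrow> ?q x' y' u) \<partial>((RS \<Otimes>\<^sub>M RS) \<Otimes>\<^sub>M RW))"
    by (intro integral_eq_nn_integral) (auto simp: split_beta' intro!: sum_nonneg)
  also have "(\<integral>\<^sup>+y. ennreal (case y of (x', y') \<Rightarrow> ?q x' y' u) \<partial>((RS \<Otimes>\<^sub>M RS) \<Otimes>\<^sub>M RW)) =
      (\<integral>\<^sup>+y. dens_zswu (fst (fst y)) (snd (fst y)) (snd y) u \<partial>((RS \<Otimes>\<^sub>M RS) \<Otimes>\<^sub>M RW))"
    by (simp add: split_beta' dens_zswu_def)
  also have "\<dots> = (\<integral>\<^sup>+y. \<integral>\<^sup>+w. dens_zswu (fst y) (snd y) w u \<partial>RW \<partial>(RS \<Otimes>\<^sub>M RS))"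
    by (subst RW.nn_integral_fst[symmetric]) simp_all
  also have "\<dots> = (\<integral>\<^sup>+z. \<integral>\<^sup>+s. \<integral>\<^sup>+w. dens_zswu z s w u \<partial>RW \<partial>RS \<partial>RS)"
    by (subst RS.nn_integral_fst[symmetric]) simp_all
  also have "enn2real \<dots> = PU u"
    by (simp add: p_lat_nn assms)
  finally have pc: "(\<integral>(x', y'). ?q x' y' u \<partial>((RS \<Otimes>\<^sub>M RS) \<Otimes>\<^sub>M RW)) = PU u" .
  have "cond_indep_density (RS \<Otimes>\<^sub>M RS) RW RU ?q"
    using proxy unfolding proxy_independence_def by blast
  from this[unfolded cond_indep_density_def Let_def, rule_format, of "(z, s)" w u]
  have "dens_zswu z s w u / PU u = dens_zsu z s u / PU u * (dens_wu w u / PU u)"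
    unfolding pc using assms by (simp add: space_pair_measure dens_zswu_def dens_zsu_def dens_wu_def split_beta')
  then show ?thesis using u by (simp add: field_simps)
qed

lemma dens_zswu_zero: "PU u = 0 \<Longrightarrow> dens_zswu z s w u = 0"
  by (simp add: dens_zswu_def dens_zero)

text \<open>
  If the integral over one of the two factors diverged, its value 0 would make the density vanish by
  the factorisation \<open>dens_zswu_eq\<close>.
\<close>

lemma ennreal_dens_zsu:
  assumes [measurable]: "z \<in> space RS" "s \<in> space RS" "u \<in> space RU"
  shows "ennreal (dens_zsu z s u) = (\<integral>\<^sup>+w. dens_zswu z s w u \<partial>RW)"
proof (cases "PU u = 0 \<or> dens_zsu z s u = 0")
  case True
  then have "dens_zswu z s w u = 0" if "w \<in> space RW" for w
    using dens_zswu_eq[OF assms(1,2) that assms(3)] by (cases "PU u = 0") (auto simp: dens_zswu_zero less_le)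
  moreover from this have "dens_zsu z s u = 0"
    unfolding dens_zsu_def by (subst Bochner_Integration.integral_cong[where g="\<lambda>_. 0"]) auto
  ultimately show ?thesis
    by (subst nn_integral_cong[where v="\<lambda>_. 0"]) auto
next
  case False
  then show ?thesis unfolding dens_zsu_def by (intro ennreal_lebesgue_integral) auto
qed

lemma ennreal_dens_wu:
  assumes [measurable]: "w \<in> space RW" "u \<in> space RU"
  shows "ennreal (dens_wu w u) = (\<integral>\<^sup>+z. \<integral>\<^sup>+s. dens_zswu z s w u \<partial>RS \<partial>RS)"
proof -
  have *: "(\<integral>\<^sup>+z. \<integral>\<^sup>+s. dens_zswu z s w u \<partial>RS \<partial>RS) = (\<integral>\<^sup>+y. dens_zswu (fst y) (snd y) w u \<partial>(RS \<Otimes>\<^sub>M RS))"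
    by (subst RS.nn_integral_fst[symmetric]) simp_all
  show ?thesis
  proof (cases "PU u = 0 \<or> dens_wu w u = 0")
    case True
    then have "dens_zswu z s w u = 0" if "z \<in> space RS" "s \<in> space RS" for z s
      using dens_zswu_eq[OF that assms(1,2)] by (cases "PU u = 0") (auto simp: dens_zswu_zero less_le)
    moreover from this have "dens_wu w u = 0"
      unfolding dens_wu_def by (subst Bochner_Integration.integral_cong[where g="\<lambda>_. 0"])
       (auto simp: space_pair_measure)
    ultimately show ?thesis
      unfolding * by (subst nn_integral_cong[where v="\<lambda>_. 0"]) (auto simp: space_pair_measure)
  next
    case False
    then show ?thesis unfolding dens_wu_def * split_beta' by (intro ennreal_lebesgue_integral) auto
  qed
qed

text \<open>By \<open>ennreal_dens_zsu\<close> the nonnegative integral equals a real number, hence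
  is finite at every point and not just almost everywhere. The single actions are dominated by their
  sum.\<close>

lemma dens_zsu_integrable:
  assumes [measurable]: "z \<in> space RS" "s \<in> space RS" "u \<in> space RU"
  shows "integrable RW (\<lambda>w. dens_zswu z s w u)" "integrable RW (\<lambda>w. d z s w u a)"
proof -
  show *: "integrable RW (\<lambda>w. dens_zswu z s w u)"
    using ennreal_less_top[of "dens_zsu z s u"] unfolding ennreal_dens_zsu[OF assms]
    by (simp add: integrable_iff_bounded)
  show "integrable RW (\<lambda>w. d z s w u a)"
    by (rule Bochner_Integration.integrable_bound[OF *])
      (auto simp: dens_zswu_def sum_nonneg intro!: member_le_sum)
qed

lemma ennreal_dens_zsua:
  assumes [measurable]: "z \<in> space RS" "s \<in> space RS" "u \<in> space RU"
  shows "ennreal (dens_zsua z s u a) = (\<integral>\<^sup>+w. d z s w u a \<partial>RW)"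
  unfolding dens_zsua_def using dens_zsu_integrable[OF assms] by (simp add: nn_integral_eq_integral)

lemma sum_dens_zsua:
  assumes [measurable]: "z \<in> space RS" "s \<in> space RS" "u \<in> space RU"
  shows "(\<Sum>a\<in>UNIV. dens_zsua z s u a) = dens_zsu z s u"
  unfolding dens_zsua_def dens_zsu_def dens_zswu_def using dens_zsu_integrable[OF assms]
  by (simp add: Bochner_Integration.integral_sum)

lemma nn_dens_wu:
  assumes [measurable]: "u \<in> space RU"
  shows "(\<integral>\<^sup>+w. dens_wu w u \<partial>RW) = PU u"
proof -
  have "(\<integral>\<^sup>+w. dens_wu w u \<partial>RW) = (\<integral>\<^sup>+w. \<integral>\<^sup>+z. \<integral>\<^sup>+s. dens_zswu z s w u \<partial>RS \<partial>RS \<partial>RW)"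
    by (intro nn_integral_cong) (simp add: ennreal_dens_wu assms)
  also have "\<dots> = (\<integral>\<^sup>+z. \<integral>\<^sup>+w. \<integral>\<^sup>+s. dens_zswu z s w u \<partial>RS \<partial>RW \<partial>RS)"
    by (rule SW.Fubini') measurable
  also have "\<dots> = (\<integral>\<^sup>+z. \<integral>\<^sup>+s. \<integral>\<^sup>+w. dens_zswu z s w u \<partial>RW \<partial>RS \<partial>RS)"
    by (intro nn_integral_cong SW.Fubini') measurable
  finally show ?thesis by (simp add: ennreal_p_lat assms)
qed

lemma nn_p_lat: "(\<integral>\<^sup>+u. PU u \<partial>RU) = 1"
proof -
  have "(\<integral>\<^sup>+u. PU u \<partial>RU) = (\<integral>\<^sup>+u. \<integral>\<^sup>+z. \<integral>\<^sup>+s. \<integral>\<^sup>+w. dens_zswu z s w u \<partial>RW \<partial>RS \<partial>RS \<partial>RU)"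
    by (intro nn_integral_cong) (simp add: ennreal_p_lat)
  also have "\<dots> = (\<integral>\<^sup>+z. \<integral>\<^sup>+u. \<integral>\<^sup>+s. \<integral>\<^sup>+w. dens_zswu z s w u \<partial>RW \<partial>RS \<partial>RU \<partial>RS)"
    by (rule SU.Fubini') measurable
  also have "\<dots> = (\<integral>\<^sup>+z. \<integral>\<^sup>+s. \<integral>\<^sup>+u. \<integral>\<^sup>+w. dens_zswu z s w u \<partial>RW \<partial>RU \<partial>RS \<partial>RS)"
    by (intro nn_integral_cong SU.Fubini') measurable
  also have "\<dots> = (\<integral>\<^sup>+z. \<integral>\<^sup>+s. \<integral>\<^sup>+w. \<integral>\<^sup>+u. dens_zswu z s w u \<partial>RU \<partial>RW \<partial>RS \<partial>RS)"
    by (intro nn_integral_cong WU.Fubini') measurable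
  finally show ?thesis by (simp add: nn_total)
qed

text \<open>Connects \<open>completeness\<close>, which speaks about U (t-1) on the sample space,
  with the integrals over u.\<close>

lemma dist_lat: "distributed (Om X) RU (lat X (t - 1)) (\<lambda>u. ennreal (PU u))"
proof (rule distributedI_nn_integral)
  fix A assume [measurable]: "A \<in> sets RU"
  have "(\<integral>\<^sup>+\<omega>. indicator A (lat X (t - 1) \<omega>) \<partial>Om X) =
      (\<integral>\<^sup>+z. \<integral>\<^sup>+s. \<integral>\<^sup>+w. \<integral>\<^sup>+u. ennreal (dens_zswu z s w u) * indicator A u \<partial>RU \<partial>RW \<partial>RS \<partial>RS)"
    using nn_expectation[of "\<lambda>(z, s, w, u, a). indicator A u"]
    by (simp add: dens_zswu_def sum_distrib_right[symmetric])
  also have "\<dots> = (\<integral>\<^sup>+z. \<integral>\<^sup>+s. \<integral>\<^sup>+u. \<integral>\<^sup>+w. ennreal (dens_zswu z s w u) * indicator A u \<partial>RW \<partial>RU \<partial>RS \<partial>RS)"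
    by (intro nn_integral_cong WU.Fubini'[symmetric]) measurable
  also have "\<dots> = (\<integral>\<^sup>+z. \<integral>\<^sup>+u. \<integral>\<^sup>+s. \<integral>\<^sup>+w. ennreal (dens_zswu z s w u) * indicator A u \<partial>RW \<partial>RS \<partial>RU \<partial>RS)"
    by (intro nn_integral_cong SU.Fubini'[symmetric]) measurable
  also have "\<dots> = (\<integral>\<^sup>+u. \<integral>\<^sup>+z. \<integral>\<^sup>+s. \<integral>\<^sup>+w. ennreal (dens_zswu z s w u) * indicator A u \<partial>RW \<partial>RS \<partial>RS \<partial>RU)"
    by (intro SU.Fubini'[symmetric]) measurable
  also have "\<dots> = (\<integral>\<^sup>+u. ennreal (PU u) * indicator A u \<partial>RU)"
    by (intro nn_integral_cong) (auto simp: ennreal_p_lat split: split_indicator)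
  finally show "(\<integral>\<^sup>+\<omega>. indicator A (lat X (t - 1) \<omega>) \<partial>Om X) =
      (\<integral>\<^sup>+u. ennreal (PU u) * indicator A u \<partial>RU)" .
qed simp_all

subsection \<open>Marginals of the observed density\<close>

lemma obs_eq: "p (z, s, w, a) = (\<integral>u. d z s w u a \<partial>RU)"
  by (simp add: obs_def)

lemma p_nonneg[simp]: "0 \<le> p y"
  by (cases y) (simp add: obs_eq)

lemma p_measurable[measurable]: "p \<in> borel_measurable (RS \<Otimes>\<^sub>M RS \<Otimes>\<^sub>M RW \<Otimes>\<^sub>M actions)"
  unfolding obs_def by measurable

text \<open>Where the integral over u diverges, \<open>obs\<close> may take the default value 0 of a
  Bochner integral instead of the marginal density. Such points have to be discarded as a null
  set.\<close>

definition regular :: "'s \<Rightarrow> 's \<Rightarrow> 'w \<Rightarrow> bool" where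
  "regular z s w \<longleftrightarrow> (\<integral>\<^sup>+u. dens_zswu z s w u \<partial>RU) < \<infinity>"

lemma ennreal_obs:
  assumes [measurable]: "z \<in> space RS" "s \<in> space RS" "w \<in> space RW" and "regular z s w"
  shows "ennreal (p (z, s, w, a)) = (\<integral>\<^sup>+u. d z s w u a \<partial>RU)"
    "integrable RU (\<lambda>u. d z s w u a)" "integrable RU (\<lambda>u. dens_zswu z s w u)"
    "(\<Sum>a\<in>UNIV. p (z, s, w, a)) = (\<integral>u. dens_zswu z s w u \<partial>RU)"
proof -
  show *: "integrable RU (\<lambda>u. dens_zswu z s w u)"
    using assms(4) by (simp add: integrable_iff_bounded regular_def)
  show **: "integrable RU (\<lambda>u. d z s w u a)" for a
    by (rule Bochner_Integration.integrable_bound[OF *])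
      (auto simp: dens_zswu_def sum_nonneg intro!: member_le_sum)
  show "ennreal (p (z, s, w, a)) = (\<integral>\<^sup>+u. d z s w u a \<partial>RU)"
    using ** by (simp add: nn_integral_eq_integral obs_eq)
  show "(\<Sum>a\<in>UNIV. p (z, s, w, a)) = (\<integral>u. dens_zswu z s w u \<partial>RU)"
    using ** by (simp add: obs_eq dens_zswu_def Bochner_Integration.integral_sum)
qed

text \<open>This is the condition of \<open>wf_model\<close> that p(s) is finite. Holding at every
  s, it makes the exceptional sets in z and w null for each fixed s.\<close>

lemma nn_cur_finite:
  assumes [measurable]: "s \<in> space RS"
  shows "(\<integral>\<^sup>+z. \<integral>\<^sup>+w. \<integral>\<^sup>+u. dens_zswu z s w u \<partial>RU \<partial>RW \<partial>RS) < \<infinity>"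
  using dens_integrable[OF assms]
  by (simp add: integrable_iff_bounded split_beta' nn_integral_quad_finite sigma_finite dens_zswu_def)

lemma AE_nn_cur_finite:
  assumes [measurable]: "s \<in> space RS"
  shows "AE z in RS. (\<integral>\<^sup>+w. \<integral>\<^sup>+u. dens_zswu z s w u \<partial>RU \<partial>RW) < \<infinity>"
  by (intro AE_nn_integral_finite nn_cur_finite[OF assms]) measurable

lemma AE_regular_w:
  assumes [measurable]: "z \<in> space RS" "s \<in> space RS" and "(\<integral>\<^sup>+w. \<integral>\<^sup>+u. dens_zswu z s w u \<partial>RU \<partial>RW) < \<infinity>"
  shows "AE w in RW. regular z s w"
  unfolding regular_def
  by (intro AE_nn_integral_finite assms(3)) measurable

lemma ennreal_p_cur:
  assumes [measurable]: "s \<in> space RS"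
  shows "ennreal (p_cur RS RW p s) = (\<integral>\<^sup>+z. \<integral>\<^sup>+w. \<integral>\<^sup>+u. dens_zswu z s w u \<partial>RU \<partial>RW \<partial>RS)"
proof -
  have *: "(\<integral>\<^sup>+(z, w, a). p (z, s, w, a) \<partial>(RS \<Otimes>\<^sub>M RW \<Otimes>\<^sub>M actions)) =
      (\<integral>\<^sup>+z. \<integral>\<^sup>+w. \<integral>\<^sup>+u. dens_zswu z s w u \<partial>RU \<partial>RW \<partial>RS)"
    apply (simp add: split_beta' nn_integral_triple_finite sigma_finite)
    apply (intro nn_integral_cong_AE)
    using AE_nn_cur_finite[OF assms] AE_space
    apply eventually_elim
    apply (intro nn_integral_cong_AE)
    subgoal for z
      using AE_regular_w[of z s] AE_space[of RW] assms
      by (auto elim!: eventually_elim2 simp: ennreal_obs nn_integral_eq_integral)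
    done
  have "ennreal (p_cur RS RW p s) = (\<integral>\<^sup>+(z, w, a). p (z, s, w, a) \<partial>(RS \<Otimes>\<^sub>M RW \<Otimes>\<^sub>M actions))"
    unfolding p_cur_def split_beta'
    using nn_cur_finite[OF assms] *
    by (intro ennreal_lebesgue_integral) (auto simp: split_beta')
  with * show ?thesis by simp
qed

subsection \<open>The conditional action probability given the latent state\<close>

text \<open>Positivity serves twice: it allows division by p(s, u), and it excludes the default
  value 0, so that the Bochner integral defining \<open>dens_su\<close> converges at this very
  s.\<close>

lemma ennreal_dens_su:
  assumes s: "s \<in> cur_support X t" and u[measurable]: "u \<in> space RU" and "0 < PU u"
  shows "0 < dens_su s u" "ennreal (dens_su s u) = (\<integral>\<^sup>+z. \<integral>\<^sup>+w. dens_zswu z s w u \<partial>RW \<partial>RS)"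
    "ennreal (dens_su s u) = (\<integral>\<^sup>+z. dens_zsu z s u \<partial>RS)"
proof -
  have sS[measurable]: "s \<in> space RS" using s by (simp add: supp_cur_def)
  have "0 < dens_su s u / PU u"
    using pos s assms(2,3) unfolding positivity_def p_cur_given_lat_def dens_su_def by blast
  then show es: "0 < dens_su s u"
    using assms(3) by (simp add: zero_less_divide_iff)
  then have "ennreal (dens_su s u) = (\<integral>\<^sup>+(z, w, a). d z s w u a \<partial>(RS \<Otimes>\<^sub>M RW \<Otimes>\<^sub>M actions))"
    unfolding dens_su_def split_beta' by (intro ennreal_lebesgue_integral) auto
  also have "\<dots> = (\<integral>\<^sup>+z. \<integral>\<^sup>+w. dens_zswu z s w u \<partial>RW \<partial>RS)"
    by (simp add: split_beta' nn_integral_triple_finite sigma_finite dens_zswu_def)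
  finally show *: "ennreal (dens_su s u) = \<dots>" .
  show "ennreal (dens_su s u) = (\<integral>\<^sup>+z. dens_zsu z s u \<partial>RS)"
    unfolding * by (intro nn_integral_cong) (simp add: ennreal_dens_zsu u sS)
qed

text \<open>One action contributes at most the sum over all actions, which is finite. The last
  inequality says g \<le> 1 for the quotient g(u) = p(a | s, u).\<close>

lemma ennreal_dens_sua:
  assumes s: "s \<in> cur_support X t" and u[measurable]: "u \<in> space RU" and "0 < PU u"
  shows "ennreal (dens_sua s u a) = (\<integral>\<^sup>+z. dens_zsua z s u a \<partial>RS)"
    "ennreal (dens_sua s u a) = (\<integral>\<^sup>+z. \<integral>\<^sup>+w. d z s w u a \<partial>RW \<partial>RS)"
    "dens_sua s u a \<le> dens_su s u"
proof -
  have sS[measurable]: "s \<in> space RS" using s by (simp add: supp_cur_def)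
  have le: "(\<integral>\<^sup>+z. dens_zsua z s u a \<partial>RS) \<le> dens_su s u"
    unfolding ennreal_dens_su(3)[OF assms]
    by (intro nn_integral_mono ennreal_leI, subst sum_dens_zsua[symmetric]) (auto intro!: member_le_sum u sS)
  then show *: "ennreal (dens_sua s u a) = (\<integral>\<^sup>+z. dens_zsua z s u a \<partial>RS)"
    unfolding dens_sua_def by (intro ennreal_lebesgue_integral) (auto simp: order.strict_trans1)
  show "ennreal (dens_sua s u a) = (\<integral>\<^sup>+z. \<integral>\<^sup>+w. d z s w u a \<partial>RW \<partial>RS)"
    unfolding * by (intro nn_integral_cong) (simp add: ennreal_dens_zsua u sS)
  show "dens_sua s u a \<le> dens_su s u"
    using le unfolding *[symmetric] by simp
qed

text \<open>The first proxy independence, with normalising constant p(s, u). The quotient on the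
  right is g(u), which does not involve z.\<close>

lemma dens_zsua_eq:
  assumes s: "s \<in> cur_support X t" and u[measurable]: "u \<in> space RU" and PU: "0 < PU u" and z: "z \<in> space RS"
  shows "dens_zsua z s u a = dens_zsu z s u * (dens_sua s u a / dens_su s u)"
proof -
  have sS[measurable]: "s \<in> space RS" using s by (simp add: supp_cur_def)
  let ?q = "\<lambda>z a (s, u). \<integral>w. d z s w u a \<partial>RW"
  have "(\<integral>(x', y'). ?q x' y' (s, u) \<partial>(RS \<Otimes>\<^sub>M actions)) =
      enn2real (\<integral>\<^sup>+y. ennreal (case y of (x', y') \<Rightarrow> ?q x' y' (s, u)) \<partial>(RS \<Otimes>\<^sub>M actions))"
    by (intro integral_eq_nn_integral) (auto simp: split_beta')
  also have "(\<integral>\<^sup>+y. ennreal (case y of (x', y') \<Rightarrow> ?q x' y' (s, u)) \<partial>(RS \<Otimes>\<^sub>M actions)) =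
      (\<integral>\<^sup>+z. (\<Sum>a\<in>UNIV. ennreal (dens_zsua z s u a)) \<partial>RS)"
    by (subst nn_integral_pair_finite) (simp_all add: dens_zsua_def)
  also have "\<dots> = (\<integral>\<^sup>+z. dens_zsu z s u \<partial>RS)"
    by (intro nn_integral_cong) (simp add: sum_dens_zsua u sS)
  also have "\<dots> = dens_su s u"
    using ennreal_dens_su[OF s u PU] by simp
  finally have pc: "(\<integral>(x', y'). ?q x' y' (s, u) \<partial>(RS \<Otimes>\<^sub>M actions)) = dens_su s u" by simp
  have "cond_indep_density RS actions (RS \<Otimes>\<^sub>M RU) ?q"
    using proxy unfolding proxy_independence_def by blast
  from this[unfolded cond_indep_density_def Let_def, rule_format, of z a "(s, u)"]
  have "dens_zsua z s u a / dens_su s u =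
      (dens_zsu z s u / dens_su s u) * (dens_sua s u a / dens_su s u)"
    unfolding pc using ennreal_dens_su(1)[OF s u PU] z u sS
    by (simp add: space_pair_measure lebesgue_integral_count_space_finite dens_zsua_def[symmetric] sum_dens_zsua dens_sua_def)
  then show ?thesis using ennreal_dens_su[OF s u PU] by (simp add: field_simps)
qed

subsection \<open>Laws of the observed variables\<close>

text \<open>The marginal density of S (t-1), kept with values in the extended nonnegative reals: it
  may be infinite on a null set.\<close>

definition dens_z where "dens_z z = (\<integral>\<^sup>+s. \<integral>\<^sup>+w. \<integral>\<^sup>+u. dens_zswu z s w u \<partial>RU \<partial>RW \<partial>RS)"

lemma AE_dens_z_finite: "AE z in RS. dens_z z < \<infinity>"
  unfolding dens_z_def using nn_total by (intro AE_nn_integral_finite) simp_all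

text \<open>At a single z nothing bounds p(z), in contrast to p(s); the equality holds where
  \<open>dens_z\<close> is finite. Almost every z is enough for \<open>completeness\<close>.\<close>

lemma AE_p_prev: "AE z in RS. ennreal (p_prev RS RW p z) = dens_z z"
  using AE_dens_z_finite AE_space
proof eventually_elim
  case (elim z)
  note [measurable] = elim(2)
  have "AE s in RS. (\<integral>\<^sup>+w. \<integral>\<^sup>+u. dens_zswu z s w u \<partial>RU \<partial>RW) < \<infinity>"
    using elim unfolding dens_z_def by (intro AE_nn_integral_finite) simp_all
  note AEs = eventually_conj[OF this AE_space]
  have *: "(\<integral>\<^sup>+(s, w, a). p (z, s, w, a) \<partial>(RS \<Otimes>\<^sub>M RW \<Otimes>\<^sub>M actions)) = dens_z z"
    unfolding dens_z_def
    apply (simp add: split_beta' nn_integral_triple_finite sigma_finite)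
    apply (intro nn_integral_cong_AE)
    apply (rule eventually_mono[OF AEs])
    apply (intro nn_integral_cong_AE)
    subgoal for s
      using AE_regular_w[of z s] AE_space[of RW] elim
      by (auto elim!: eventually_elim2 simp: ennreal_obs nn_integral_eq_integral)
    done
  have "ennreal (p_prev RS RW p z) = (\<integral>\<^sup>+(s, w, a). p (z, s, w, a) \<partial>(RS \<Otimes>\<^sub>M RW \<Otimes>\<^sub>M actions))"
    unfolding p_prev_def split_beta' using elim(1) *
    by (intro ennreal_lebesgue_integral) (auto simp: split_beta')
  with * show ?case by simp
qed

lemma dens_z_measurable[measurable]: "dens_z \<in> borel_measurable RS"
  unfolding dens_z_def[abs_def] by measurable

lemma dist_st_prev: "distributed (Om X) RS (st X (t - 1)) dens_z"
proof (rule distributedI_nn_integral)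
  fix A assume [measurable]: "A \<in> sets RS"
  have "(\<integral>\<^sup>+\<omega>. indicator A (st X (t - 1) \<omega>) \<partial>Om X) =
      (\<integral>\<^sup>+z. \<integral>\<^sup>+s. \<integral>\<^sup>+w. \<integral>\<^sup>+u. ennreal (dens_zswu z s w u) * indicator A z \<partial>RU \<partial>RW \<partial>RS \<partial>RS)"
    using nn_expectation[of "\<lambda>(z, s, w, u, a). indicator A z"]
    by (simp add: dens_zswu_def sum_distrib_right[symmetric])
  also have "\<dots> = (\<integral>\<^sup>+z. dens_z z * indicator A z \<partial>RS)"
    by (intro nn_integral_cong) (auto simp: dens_z_def split: split_indicator)
  finally show "(\<integral>\<^sup>+\<omega>. indicator A (st X (t - 1) \<omega>) \<partial>Om X) = \<dots>" .
qed simp_all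

text \<open>Produces the almost sure premise of \<open>completeness\<close>. Up to a null set,
  points off the support have density 0 in the law of S (t-1).\<close>

lemma AE_st_prev:
  assumes "AE z in RS. z \<in> supp_prev RS RW p \<longrightarrow> Q z"
  shows "AE \<omega> in Om X. Q (st X (t - 1) \<omega>)"
proof (rule AE_distrD[OF st_prev_measurable])
  show "AE z in distr (Om X) RS (st X (t - 1)). Q z"
    unfolding distributed_distr_eq_density[OF dist_st_prev]
  proof (subst AE_density)
    show "AE z in RS. 0 < dens_z z \<longrightarrow> Q z"
      using assms AE_p_prev AE_space by eventually_elim (metis (mono_tags, lifting) ennreal_less_zero_iff mem_Collect_eq supp_prev_def)
  qed simp
qed

lemma dist_st: "distributed (Om X) RS (st X t) (\<lambda>s. ennreal (p_cur RS RW p s))"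
proof (rule distributedI_nn_integral)
  have "(\<lambda>s. ennreal (p_cur RS RW p s)) \<in> borel_measurable RS \<longleftrightarrow>
      (\<lambda>s. \<integral>\<^sup>+z. \<integral>\<^sup>+w. \<integral>\<^sup>+u. dens_zswu z s w u \<partial>RU \<partial>RW \<partial>RS) \<in> borel_measurable RS"
    by (rule measurable_cong) (rule ennreal_p_cur)
  then show "(\<lambda>s. ennreal (p_cur RS RW p s)) \<in> borel_measurable RS" by simp
next
  fix A assume [measurable]: "A \<in> sets RS"
  have "(\<integral>\<^sup>+\<omega>. indicator A (st X t \<omega>) \<partial>Om X) =
      (\<integral>\<^sup>+z. \<integral>\<^sup>+s. \<integral>\<^sup>+w. \<integral>\<^sup>+u. ennreal (dens_zswu z s w u) * indicator A s \<partial>RU \<partial>RW \<partial>RS \<partial>RS)"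
    using nn_expectation[of "\<lambda>(z, s, w, u, a). indicator A s"]
    by (simp add: dens_zswu_def sum_distrib_right[symmetric])
  also have "\<dots> = (\<integral>\<^sup>+s. \<integral>\<^sup>+z. \<integral>\<^sup>+w. \<integral>\<^sup>+u. ennreal (dens_zswu z s w u) * indicator A s \<partial>RU \<partial>RW \<partial>RS \<partial>RS)"
    by (rule SS.Fubini'[symmetric]) measurable
  also have "\<dots> = (\<integral>\<^sup>+s. ennreal (p_cur RS RW p s) * indicator A s \<partial>RS)"
    by (intro nn_integral_cong) (auto simp: ennreal_p_cur split: split_indicator)
  finally show "(\<integral>\<^sup>+\<omega>. indicator A (st X t \<omega>) \<partial>Om X) = \<dots>" .
qed simp

text \<open>Needed so that equality of the observed laws of two models can be turned into equality
  of their observed densities almost everywhere. At irregular points \<open>obs\<close> may be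
  wrong, but these are null in w for almost all (z, s).\<close>

lemma dist_obs: "distributed (Om X) (obs_space RS RW) (obs_var X t) (\<lambda>y. ennreal (p y))"
  unfolding obs_space_def
proof (rule distributedI_nn_integral)
  show "obs_var X t \<in> measurable (Om X) (RS \<Otimes>\<^sub>M RS \<Otimes>\<^sub>M RW \<Otimes>\<^sub>M actions)"
    unfolding obs_var_def by measurable
next
  fix A assume [measurable]: "A \<in> sets (RS \<Otimes>\<^sub>M RS \<Otimes>\<^sub>M RW \<Otimes>\<^sub>M (actions :: 'a measure))"
  have *: "(\<integral>\<^sup>+w. (\<Sum>a\<in>UNIV. (\<integral>\<^sup>+u. d z s w u a \<partial>RU) * indicator A (z, s, w, a)) \<partial>RW) =
      (\<integral>\<^sup>+w. (\<Sum>a\<in>UNIV. p (z, s, w, a) * indicator A (z, s, w, a)) \<partial>RW)"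
    if "z \<in> space RS" "s \<in> space RS" "(\<integral>\<^sup>+w. \<integral>\<^sup>+u. dens_zswu z s w u \<partial>RU \<partial>RW) < \<infinity>" for z s
    using AE_regular_w[OF that] AE_space
    by (intro nn_integral_cong_AE, eventually_elim) (simp add: ennreal_obs(1)[symmetric] that)
  have "(\<integral>\<^sup>+\<omega>. indicator A (obs_var X t \<omega>) \<partial>Om X) =
      (\<integral>\<^sup>+z. \<integral>\<^sup>+s. \<integral>\<^sup>+w. \<integral>\<^sup>+u. (\<Sum>a\<in>UNIV. ennreal (d z s w u a) * indicator A (z, s, w, a)) \<partial>RU \<partial>RW \<partial>RS \<partial>RS)"
    using nn_expectation[of "\<lambda>(z, s, w, u, a). indicator A (z, s, w, a)"]
    by (simp add: obs_var_def)
  also have "\<dots> =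
      (\<integral>\<^sup>+z. \<integral>\<^sup>+s. \<integral>\<^sup>+w. (\<Sum>a\<in>UNIV. (\<integral>\<^sup>+u. d z s w u a \<partial>RU) * indicator A (z, s, w, a)) \<partial>RW \<partial>RS \<partial>RS)"
    by (intro nn_integral_cong, subst nn_integral_sum) (simp_all add: nn_integral_multc del: sum_ennreal)
  also have "\<dots> = (\<integral>\<^sup>+z. \<integral>\<^sup>+s. \<integral>\<^sup>+w. (\<Sum>a\<in>UNIV. p (z, s, w, a) * indicator A (z, s, w, a)) \<partial>RW \<partial>RS \<partial>RS)"
  proof (intro nn_integral_cong_AE, use AE_dens_z_finite AE_space in eventually_elim)
    case (elim z)
    then have "AE s in RS. (\<integral>\<^sup>+w. \<integral>\<^sup>+u. dens_zswu z s w u \<partial>RU \<partial>RW) < \<infinity>"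
      unfolding dens_z_def by (intro AE_nn_integral_finite) simp_all
    note AEs = eventually_conj[OF this AE_space]
    show ?case
      by (rule nn_integral_cong_AE, rule eventually_mono[OF AEs]) (use * elim in simp)
  qed
  also have "\<dots> = (\<integral>\<^sup>+y. ennreal (p y) * indicator A y \<partial>(RS \<Otimes>\<^sub>M RS \<Otimes>\<^sub>M RW \<Otimes>\<^sub>M actions))"
    by (subst nn_integral_quad_finite) (simp_all add: sigma_finite)
  finally show "(\<integral>\<^sup>+\<omega>. indicator A (obs_var X t \<omega>) \<partial>Om X) = \<dots>" .
qed simp

text \<open>With w outermost, the total mass 1 forces finite inner integrals for almost every w, and
  the irregular points are then null in z and s. Since p(w) is only used under an integral, the
  exceptional w do not matter.\<close>

lemma AE_p_meas: "AE w in RW. ennreal (p_meas RS p w) = (\<integral>\<^sup>+u. dens_wu w u \<partial>RU)"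
proof -
  have "(\<integral>\<^sup>+w. \<integral>\<^sup>+z. \<integral>\<^sup>+s. \<integral>\<^sup>+u. dens_zswu z s w u \<partial>RU \<partial>RS \<partial>RS \<partial>RW) =
      (\<integral>\<^sup>+z. \<integral>\<^sup>+w. \<integral>\<^sup>+s. \<integral>\<^sup>+u. dens_zswu z s w u \<partial>RU \<partial>RS \<partial>RW \<partial>RS)"
    by (rule SW.Fubini') measurable
  also have "\<dots> = (\<integral>\<^sup>+z. \<integral>\<^sup>+s. \<integral>\<^sup>+w. \<integral>\<^sup>+u. dens_zswu z s w u \<partial>RU \<partial>RW \<partial>RS \<partial>RS)"
    by (intro nn_integral_cong SW.Fubini') measurable
  finally have "AE w in RW. (\<integral>\<^sup>+z. \<integral>\<^sup>+s. \<integral>\<^sup>+u. dens_zswu z s w u \<partial>RU \<partial>RS \<partial>RS) < \<infinity>"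
    by (intro AE_nn_integral_finite) (simp_all add: nn_total)
  then show ?thesis using AE_space
  proof eventually_elim
    case (elim w)
    note [measurable] = elim(2)
    have "AE z in RS. (\<integral>\<^sup>+s. \<integral>\<^sup>+u. dens_zswu z s w u \<partial>RU \<partial>RS) < \<infinity>"
      using elim by (intro AE_nn_integral_finite) simp_all
    note AEz = eventually_conj[OF this AE_space]
    have "(\<integral>\<^sup>+(z, s, a). p (z, s, w, a) \<partial>(RS \<Otimes>\<^sub>M RS \<Otimes>\<^sub>M actions)) =
        (\<integral>\<^sup>+z. \<integral>\<^sup>+s. \<integral>\<^sup>+u. dens_zswu z s w u \<partial>RU \<partial>RS \<partial>RS)"
      apply (simp add: split_beta' nn_integral_triple_finite sigma_finite)
      apply (intro nn_integral_cong_AE)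
      apply (rule eventually_mono[OF AEz])
      apply (intro nn_integral_cong_AE)
      subgoal premises prems for z
      proof -
        from prems have [measurable]: "z \<in> space RS" by simp
        have "AE s in RS. regular z s w"
          unfolding regular_def by (rule AE_nn_integral_finite) (use prems in simp_all)
        with AE_space show ?thesis
          by eventually_elim (use elim prems in \<open>simp add: ennreal_obs nn_integral_eq_integral\<close>)
      qed
      done
    note * = this
    have "ennreal (p_meas RS p w) = (\<integral>\<^sup>+(z, s, a). p (z, s, w, a) \<partial>(RS \<Otimes>\<^sub>M RS \<Otimes>\<^sub>M actions))"
      unfolding p_meas_def split_beta' using elim(1) *
      by (intro ennreal_lebesgue_integral) (auto simp: split_beta')
    also note *
    also have "(\<integral>\<^sup>+z. \<integral>\<^sup>+s. \<integral>\<^sup>+u. dens_zswu z s w u \<partial>RU \<partial>RS \<partial>RS) =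
        (\<integral>\<^sup>+z. \<integral>\<^sup>+u. \<integral>\<^sup>+s. dens_zswu z s w u \<partial>RS \<partial>RU \<partial>RS)"
      by (intro nn_integral_cong SU.Fubini'[symmetric]) measurable
    also have "\<dots> = (\<integral>\<^sup>+u. \<integral>\<^sup>+z. \<integral>\<^sup>+s. dens_zswu z s w u \<partial>RS \<partial>RS \<partial>RU)"
      by (intro SU.Fubini'[symmetric]) measurable
    also have "\<dots> = (\<integral>\<^sup>+u. dens_wu w u \<partial>RU)"
      by (intro nn_integral_cong) (simp add: ennreal_dens_wu elim)
    finally show ?case .
  qed
qed

subsection \<open>Potential actions\<close>

text \<open>The arguments are ordered so that \<open>dens_pot_su x\<close> is literally the density
  in \<open>latent_exchangeability\<close>.\<close>

definition dens_pot_su :: "'s \<Rightarrow> 'a \<Rightarrow> 's \<Rightarrow> 'u \<Rightarrow> real" where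
  "dens_pot_su x b s u = (\<integral>(z, w, a). dp x z s w u a b \<partial>(RS \<Otimes>\<^sub>M RW \<Otimes>\<^sub>M actions))"

lemma dens_pot_section_measurable[measurable (raw)]:
  assumes x: "x \<in> space RS" and [measurable]: "f \<in> measurable N RS" "g \<in> measurable N RS" "h \<in> measurable N RW" "k \<in> measurable N RU"
  shows "(\<lambda>y. dp x (f y) (g y) (h y) (k y) a b) \<in> borel_measurable N"
proof -
  note [measurable] = dens_pot_measurable[OF x]
  show ?thesis by measurable
qed

lemma sum_dens_pot:
  assumes "x \<in> space RS"
  shows "(\<Sum>b\<in>UNIV. \<Sum>a\<in>UNIV. dp x z s w u a b) = dens_zswu z s w u"
  unfolding dens_zswu_def dens_eq_sum_pot[OF assms] by (rule sum.swap)

lemma sum_dens_pot_le: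
  assumes "x \<in> space RS"
  shows "(\<Sum>a\<in>UNIV. dp x z s w u a b) \<le> dens_zswu z s w u"
  unfolding sum_dens_pot[OF assms, symmetric]
  by (rule member_le_sum) (auto intro!: sum_nonneg simp: assms)

text \<open>Fixing the potential action can only decrease the density, so finiteness is inherited
  from p(s, u).\<close>

lemma ennreal_dens_pot_su:
  assumes x[measurable]: "x \<in> space RS" and s[measurable]: "s \<in> space RS" and u[measurable]: "u \<in> space RU"
    and fin: "(\<integral>\<^sup>+z. \<integral>\<^sup>+w. dens_zswu z s w u \<partial>RW \<partial>RS) < \<infinity>"
  shows "ennreal (dens_pot_su x b s u) = (\<integral>\<^sup>+z. \<integral>\<^sup>+w. (\<Sum>a\<in>UNIV. dp x z s w u a b) \<partial>RW \<partial>RS)"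
proof -
  note [measurable] = dens_pot_measurable[OF x]
  have *: "(\<integral>\<^sup>+(z, w, a). dp x z s w u a b \<partial>(RS \<Otimes>\<^sub>M RW \<Otimes>\<^sub>M actions)) =
      (\<integral>\<^sup>+z. \<integral>\<^sup>+w. (\<Sum>a\<in>UNIV. dp x z s w u a b) \<partial>RW \<partial>RS)"
    by (simp add: split_beta' nn_integral_triple_finite sigma_finite x)
  also have "\<dots> \<le> (\<integral>\<^sup>+z. \<integral>\<^sup>+w. dens_zswu z s w u \<partial>RW \<partial>RS)"
    by (intro nn_integral_mono ennreal_leI sum_dens_pot_le x)
  finally have "ennreal (dens_pot_su x b s u) =
      (\<integral>\<^sup>+(z, w, a). dp x z s w u a b \<partial>(RS \<Otimes>\<^sub>M RW \<Otimes>\<^sub>M actions))"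
    unfolding dens_pot_su_def split_beta' using fin
    by (intro ennreal_lebesgue_integral) (auto simp: x order.strict_trans1)
  with * show ?thesis by simp
qed

lemma sum_dens_pot_su:
  assumes x[measurable]: "x \<in> space RS" and s[measurable]: "s \<in> space RS" and u[measurable]: "u \<in> space RU"
    and fin: "(\<integral>\<^sup>+z. \<integral>\<^sup>+w. dens_zswu z s w u \<partial>RW \<partial>RS) < \<infinity>"
  shows "(\<Sum>b\<in>UNIV. ennreal (dens_pot_su x b s u)) = (\<integral>\<^sup>+z. \<integral>\<^sup>+w. dens_zswu z s w u \<partial>RW \<partial>RS)"
  unfolding ennreal_dens_pot_su[OF assms]
  apply (subst nn_integral_sum[symmetric], measurable)
  apply (intro nn_integral_cong)
  apply (subst nn_integral_sum[symmetric], measurable)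
  apply (intro nn_integral_cong)
  apply (simp add: sum_nonneg x sum_dens_pot)
  done

lemma dens_pot_su_measurable[measurable]:
  assumes x: "x \<in> space RS" and [measurable]: "u \<in> space RU"
  shows "(\<lambda>s. dens_pot_su x b s u) \<in> borel_measurable RS"
proof -
  note [measurable] = dens_pot_measurable[OF x]
  show ?thesis unfolding dens_pot_su_def by measurable
qed

lemma dens_pot_su_nonneg[simp]: "x \<in> space RS \<Longrightarrow> 0 \<le> dens_pot_su x b s u"
  unfolding dens_pot_su_def by (auto intro!: Bochner_Integration.integral_nonneg)

text \<open>At the intervened value, finiteness of p(s, u) comes from positivity. Other state values
  are met only under an integral, so almost every one of them suffices.\<close>

lemma AE_nn_cur_lat:
  assumes u[measurable]: "u \<in> space RU"
  shows "AE s in RS. (\<integral>\<^sup>+z. \<integral>\<^sup>+w. dens_zswu z s w u \<partial>RW \<partial>RS) < \<infinity>"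
    and "(\<integral>\<^sup>+s. \<integral>\<^sup>+z. \<integral>\<^sup>+w. dens_zswu z s w u \<partial>RW \<partial>RS \<partial>RS) = PU u"
proof -
  have "(\<integral>\<^sup>+s. \<integral>\<^sup>+z. \<integral>\<^sup>+w. dens_zswu z s w u \<partial>RW \<partial>RS \<partial>RS) =
      (\<integral>\<^sup>+z. \<integral>\<^sup>+s. \<integral>\<^sup>+w. dens_zswu z s w u \<partial>RW \<partial>RS \<partial>RS)"
    by (rule SS.Fubini') measurable
  then show *: "(\<integral>\<^sup>+s. \<integral>\<^sup>+z. \<integral>\<^sup>+w. dens_zswu z s w u \<partial>RW \<partial>RS \<partial>RS) = PU u"
    by (simp add: ennreal_p_lat u)
  then show "AE s in RS. (\<integral>\<^sup>+z. \<integral>\<^sup>+w. dens_zswu z s w u \<partial>RW \<partial>RS) < \<infinity>"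
    by (intro AE_nn_integral_finite) simp_all
qed

text \<open>The left-hand side is \<open>p(b, u)\<close>, so this says \<open>p(b | u) = p(b | s, u)\<close>.\<close>

lemma pot_given_lat:
  assumes s: "s \<in> cur_support X t" and u[measurable]: "u \<in> space RU" and PU: "0 < PU u"
  shows "(\<integral>\<^sup>+s'. \<integral>\<^sup>+z. \<integral>\<^sup>+w. (\<Sum>a\<in>UNIV. dp s z s' w u a b) \<partial>RW \<partial>RS \<partial>RS) =
      PU u * dens_pot_su s b s u / dens_su s u"
proof -
  have sS[measurable]: "s \<in> space RS" using s by (simp add: supp_cur_def)
  have eb: "AE s' in RS. ennreal (dens_pot_su s b s' u) =
      (\<integral>\<^sup>+z. \<integral>\<^sup>+w. (\<Sum>a\<in>UNIV. dp s z s' w u a b) \<partial>RW \<partial>RS)" for b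
    using AE_nn_cur_lat(1)[OF u] AE_space by eventually_elim (rule ennreal_dens_pot_su[OF sS _ u])
  have tot: "(\<Sum>b\<in>UNIV. \<integral>\<^sup>+s'. dens_pot_su s b s' u \<partial>RS) = PU u"
  proof -
    have "(\<Sum>b\<in>UNIV. \<integral>\<^sup>+s'. dens_pot_su s b s' u \<partial>RS) =
        (\<integral>\<^sup>+s'. (\<Sum>b\<in>UNIV. ennreal (dens_pot_su s b s' u)) \<partial>RS)"
      by (subst nn_integral_sum) (simp_all add: sS u)
    also have "\<dots> = (\<integral>\<^sup>+s'. \<integral>\<^sup>+z. \<integral>\<^sup>+w. dens_zswu z s' w u \<partial>RW \<partial>RS \<partial>RS)"
      by (intro nn_integral_cong_AE) (use AE_nn_cur_lat(1)[OF u] AE_space in eventually_elim, rule sum_dens_pot_su[OF sS _ u])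
    also have "\<dots> = PU u" by (rule AE_nn_cur_lat(2)[OF u])
    finally show ?thesis .
  qed
  \<comment> \<open>One potential action contributes at most the total p(u), hence the integral
    converges.\<close>
  have Q: "ennreal (\<integral>s'. dens_pot_su s b s' u \<partial>RS) = (\<integral>\<^sup>+s'. dens_pot_su s b s' u \<partial>RS)" for b
  proof -
    have "(\<integral>\<^sup>+s'. dens_pot_su s b s' u \<partial>RS) \<le> ennreal (PU u)"
      unfolding tot[symmetric] by (intro member_le_sum) auto
    then show ?thesis
      by (intro ennreal_lebesgue_integral) (auto simp: sS u order.strict_trans1)
  qed
  have m: "case_prod (\<lambda>b s'. dens_pot_su s b s' u) \<in> borel_measurable (count_space (UNIV :: 'a set) \<Otimes>\<^sub>M RS)"
    by (rule measurable_pair_measure_countable1) (auto simp: sS u)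
  have "(\<integral>(b', s'). dens_pot_su s b' s' u \<partial>(actions \<Otimes>\<^sub>M RS)) =
      enn2real (\<integral>\<^sup>+y. ennreal (case y of (b', s') \<Rightarrow> dens_pot_su s b' s' u) \<partial>(actions \<Otimes>\<^sub>M RS))"
    using m by (intro integral_eq_nn_integral) (auto simp: sS)
  also have "(\<integral>\<^sup>+y. ennreal (case y of (b', s') \<Rightarrow> dens_pot_su s b' s' u) \<partial>(actions \<Otimes>\<^sub>M RS)) = PU u"
    using m by (subst RS.nn_integral_fst[symmetric]) (simp_all add: nn_integral_count_space_finite tot)
  finally have pc: "(\<integral>(b', s'). dens_pot_su s b' s' u \<partial>(actions \<Otimes>\<^sub>M RS)) = PU u" by simp
  have "ennreal (\<Sum>b\<in>UNIV. dens_pot_su s b s u) = dens_su s u"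
    unfolding ennreal_dens_su(2)[OF s u PU]
    using sum_dens_pot_su[OF sS sS u] ennreal_dens_su(2)[OF s u PU, symmetric] by (simp add: sS)
  then have sum: "(\<Sum>b\<in>UNIV. dens_pot_su s b s u) = dens_su s u"
    by (subst (asm) ennreal_inj) (auto simp: sS sum_nonneg)
  \<comment> \<open>Exchangeability for do(S t = s) is evaluated at the state value s itself; there
    the sum over b is p(s, u).\<close>
  have "cond_indep_density actions RS RU (dens_pot_su s)"
    using exch sS unfolding latent_exchangeability_def dens_pot_su_def[abs_def] by blast
  from this[unfolded cond_indep_density_def Let_def, rule_format, of b s u]
  have "dens_pot_su s b s u / PU u = ((\<integral>s'. dens_pot_su s b s' u \<partial>RS) / PU u) * (dens_su s u / PU u)"
    unfolding pc using PU u sS by (simp add: lebesgue_integral_count_space_finite sum)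
  then have *: "(\<integral>s'. dens_pot_su s b s' u \<partial>RS) = PU u * dens_pot_su s b s u / dens_su s u"
    using PU ennreal_dens_su(1)[OF s u PU] by (simp add: field_simps)
  have "(\<integral>\<^sup>+s'. \<integral>\<^sup>+z. \<integral>\<^sup>+w. (\<Sum>a\<in>UNIV. dp s z s' w u a b) \<partial>RW \<partial>RS \<partial>RS) =
      (\<integral>\<^sup>+s'. dens_pot_su s b s' u \<partial>RS)"
    using eb[of b] by (intro nn_integral_cong_AE) (auto elim!: eventually_mono)
  then show ?thesis unfolding Q[symmetric] * .
qed

text \<open>By consistency the diagonal terms \<open>a = b\<close> already sum up to \<open>p(s)\<close>, which is finite.\<close>

lemma consistent_off_diagonal:
  assumes s: "s \<in> cur_support X t" and "a \<noteq> b"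
  shows "AE u in RU. (\<integral>\<^sup>+z. \<integral>\<^sup>+w. dp s z s w u a b \<partial>RW \<partial>RS) = 0"
proof -
  have sS[measurable]: "s \<in> space RS" and ps: "0 < p_cur RS RW p s" using s by (auto simp: supp_cur_def)
  note [measurable] = dens_pot_measurable[OF sS]
  \<comment> \<open>\<open>F a b\<close> is the joint density of S t = s, A t = a and A t^(s) = b,
    at this s.\<close>
  define F where "F a b = (\<integral>\<^sup>+z. \<integral>\<^sup>+w. \<integral>\<^sup>+u. dp s z s w u a b \<partial>RU \<partial>RW \<partial>RS)" for a b
  have sumF: "(\<Sum>a\<in>UNIV. \<Sum>b\<in>UNIV. F a b) = p_cur RS RW p s"
  proof -
    have "(\<Sum>a\<in>UNIV. \<Sum>b\<in>UNIV. F a b) =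
        (\<integral>\<^sup>+z. \<integral>\<^sup>+w. \<integral>\<^sup>+u. (\<Sum>a\<in>UNIV. \<Sum>b\<in>UNIV. ennreal (dp s z s w u a b)) \<partial>RU \<partial>RW \<partial>RS)"
      unfolding F_def sum.cartesian_product split_beta'
      apply (subst nn_integral_sum[symmetric], measurable)
      apply (intro nn_integral_cong)
      apply (subst nn_integral_sum[symmetric], measurable)
      apply (intro nn_integral_cong)
      apply (subst nn_integral_sum[symmetric], measurable)
      done
    also have "\<dots> = (\<integral>\<^sup>+z. \<integral>\<^sup>+w. \<integral>\<^sup>+u. dens_zswu z s w u \<partial>RU \<partial>RW \<partial>RS)"
      by (simp add: sS sum_nonneg dens_zswu_def dens_eq_sum_pot[OF sS])
    finally show ?thesis by (simp add: ennreal_p_cur sS)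
  qed
  have Ffin: "F a b < \<infinity>" for a b
  proof -
    have "F a b \<le> (\<Sum>b\<in>UNIV. F a b)" by (rule member_le_sum) auto
    also have "\<dots> \<le> (\<Sum>a\<in>UNIV. \<Sum>b\<in>UNIV. F a b)" by (rule member_le_sum) auto
    finally show ?thesis unfolding sumF by (simp add: order.strict_trans1)
  qed
  then have Fne: "F a b \<noteq> \<top>" for a b
    by (simp add: less_top)
  \<comment> \<open>\<open>consistency\<close> is stated with Bochner integrals; finiteness of
    \<open>F\<close> shows that they are not default values.\<close>
  have diag: "ennreal (\<integral>(z, w, u). dp s z s w u a a \<partial>(RS \<Otimes>\<^sub>M RW \<Otimes>\<^sub>M RU)) = F a a" for a
  proof -
    have *: "(\<integral>\<^sup>+(z, w, u). dp s z s w u a a \<partial>(RS \<Otimes>\<^sub>M RW \<Otimes>\<^sub>M RU)) = F a a"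
      unfolding F_def
      apply (subst WU.nn_integral_fst[symmetric])
       apply (simp add: sS split_beta')
      apply (intro nn_integral_cong)
      apply simp
      apply (subst RU.nn_integral_fst[symmetric])
       apply (simp_all add: sS split_beta')
      done
    have "ennreal (\<integral>(z, w, u). dp s z s w u a a \<partial>(RS \<Otimes>\<^sub>M RW \<Otimes>\<^sub>M RU)) =
        (\<integral>\<^sup>+(z, w, u). dp s z s w u a a \<partial>(RS \<Otimes>\<^sub>M RW \<Otimes>\<^sub>M RU))"
      unfolding split_beta' using * Ffin[of a a]
      by (intro ennreal_lebesgue_integral) (auto simp: split_beta' sS)
    with * show ?thesis by simp
  qed
  have "(\<Sum>a\<in>UNIV. \<integral>(z, w, u). dp s z s w u a a \<partial>(RS \<Otimes>\<^sub>M RW \<Otimes>\<^sub>M RU)) = p_cur RS RW p s"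
    using consistent s ps unfolding consistency_def by (auto simp: divide_eq_1_iff)
  then have "(\<Sum>a\<in>UNIV. F a a) = (\<Sum>a\<in>UNIV. \<Sum>b\<in>UNIV. F a b)"
    unfolding sumF diag[symmetric]
    by (subst sum_ennreal) (auto intro!: Bochner_Integration.integral_nonneg simp: sS)
  also have "\<dots> = (\<Sum>a\<in>UNIV. F a a + (\<Sum>b\<in>UNIV - {a}. F a b))"
    by (intro sum.cong refl sum.remove) auto
  also have "\<dots> = (\<Sum>a\<in>UNIV. F a a) + (\<Sum>a\<in>UNIV. \<Sum>b\<in>UNIV - {a}. F a b)"
    by (rule sum.distrib)
  finally have "(\<Sum>a\<in>UNIV. \<Sum>b\<in>UNIV - {a}. F a b) = 0"
    using Fne ennreal_add_left_cancel[of "\<Sum>a\<in>UNIV. F a a" 0] by auto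
  then have "F a b = 0"
    using \<open>a \<noteq> b\<close> by (auto simp: sum_nonneg_eq_0_iff)
  \<comment> \<open>With u outermost, a vanishing integral says that almost every u has vanishing
    inner integral.\<close>
  moreover have "F a b = (\<integral>\<^sup>+u. \<integral>\<^sup>+z. \<integral>\<^sup>+w. dp s z s w u a b \<partial>RW \<partial>RS \<partial>RU)"
  proof -
    have "F a b = (\<integral>\<^sup>+z. \<integral>\<^sup>+u. \<integral>\<^sup>+w. dp s z s w u a b \<partial>RW \<partial>RU \<partial>RS)"
      unfolding F_def by (intro nn_integral_cong WU.Fubini'[symmetric]) (measurable; rule sS)
    also have "\<dots> = (\<integral>\<^sup>+u. \<integral>\<^sup>+z. \<integral>\<^sup>+w. dp s z s w u a b \<partial>RW \<partial>RS \<partial>RU)"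
      by (intro SU.Fubini'[symmetric]) (measurable; rule sS)
    finally show ?thesis .
  qed
  ultimately have "(\<integral>\<^sup>+u. \<integral>\<^sup>+z. \<integral>\<^sup>+w. dp s z s w u a b \<partial>RW \<partial>RS \<partial>RU) = 0"
    by simp
  then show ?thesis
    by (subst (asm) nn_integral_0_iff_AE) (auto simp: sS)
qed

text \<open>At fixed s and u, the observed action b gives a row sum and the potential action b a
  column sum of the same matrix \<open>F\<close>. Consistency makes \<open>F\<close> diagonal, so
  both equal \<open>F b b\<close>.\<close>

lemma AE_dens_pot_su_eq:
  assumes s: "s \<in> cur_support X t"
  shows "AE u in RU. 0 < PU u \<longrightarrow> dens_pot_su s b s u = dens_sua s u b"
proof -
  have sS[measurable]: "s \<in> space RS" using s by (simp add: supp_cur_def)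
  have "AE u in RU. \<forall>a. \<forall>b. a \<noteq> b \<longrightarrow> (\<integral>\<^sup>+z. \<integral>\<^sup>+w. dp s z s w u a b \<partial>RW \<partial>RS) = 0"
    unfolding AE_all_countable using consistent_off_diagonal[OF s] by auto
  then show ?thesis using AE_space
  proof eventually_elim
    case (elim u)
    then have u[measurable]: "u \<in> space RU" by simp
    show ?case
    proof
      assume PU: "0 < PU u"
      note [measurable] = dens_pot_measurable[OF sS]
      define F where "F a b = (\<integral>\<^sup>+z. \<integral>\<^sup>+w. dp s z s w u a b \<partial>RW \<partial>RS)" for a b
      have F0: "F a b = 0" if "a \<noteq> b" for a b
        using that elim by (simp add: F_def)
      have "ennreal (dens_sua s u b) = (\<Sum>b'\<in>UNIV. F b b')"
        unfolding ennreal_dens_sua(2)[OF s u PU] dens_eq_sum_pot[OF sS] F_def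
        apply (subst nn_integral_sum[symmetric], measurable)
        apply (intro nn_integral_cong)
        apply (subst nn_integral_sum[symmetric], measurable)
        apply (simp add: sS)
        done
      also have "\<dots> = (\<Sum>b'\<in>{b}. F b b')"
        by (intro sum.mono_neutral_right) (auto intro!: F0)
      also have "\<dots> = (\<Sum>a\<in>{b}. F a b)" by simp
      also have "\<dots> = (\<Sum>a\<in>UNIV. F a b)"
        by (intro sum.mono_neutral_left) (auto intro!: F0)
      also have "\<dots> = ennreal (dens_pot_su s b s u)"
        using ennreal_dens_pot_su[OF sS sS u, of b] ennreal_dens_su(2)[OF s u PU, symmetric] unfolding F_def
        apply (subst nn_integral_sum[symmetric], measurable)
        apply (simp add: sS)
        apply (intro nn_integral_cong)
        apply (subst nn_integral_sum[symmetric], measurable)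
        apply (simp add: sS)
        done
      finally show "dens_pot_su s b s u = dens_sua s u b" by (simp add: sS)
    qed
  qed
qed

text \<open>Adjustment for the latent confounder. The swaps move u outermost and produce the
  left-hand side of \<open>pot_given_lat\<close>; consistency, in the form of
  \<open>AE_dens_pot_su_eq\<close>, then replaces the potential action by the observed one.\<close>

lemma pot_prob_eq:
  assumes s: "s \<in> cur_support X t"
  shows "ennreal (pot_prob X t s a) = (\<integral>\<^sup>+u. PU u * (dens_sua s u a / dens_su s u) \<partial>RU)"
proof -
  have sS[measurable]: "s \<in> space RS" using s by (simp add: supp_cur_def)
  note [measurable] = dens_pot_measurable[OF sS]
  have [measurable]: "pot X t s \<in> measurable (Om X) actions"
    using distributed_measurable[OF dist_pot[OF sS]] by (auto simp: measurable_pair_iff comp_def)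
  have "ennreal (pot_prob X t s a) = emeasure (Om X) {\<omega> \<in> space (Om X). pot X t s \<omega> = a}"
    unfolding pot_prob_def by (simp add: emeasure_eq_measure)
  also have "\<dots> = (\<integral>\<^sup>+\<omega>. indicator {\<omega> \<in> space (Om X). pot X t s \<omega> = a} \<omega> \<partial>Om X)"
    by (rule nn_integral_indicator[symmetric]) measurable
  also have "\<dots> = (\<integral>\<^sup>+\<omega>. indicator {a} (pot X t s \<omega>) \<partial>Om X)"
    by (intro nn_integral_cong) (simp add: indicator_def)
  also have "\<dots> =
      (\<integral>\<^sup>+z. \<integral>\<^sup>+s'. \<integral>\<^sup>+w. \<integral>\<^sup>+u. (\<Sum>a'\<in>UNIV. \<Sum>b\<in>UNIV. ennreal (dp s z s' w u a' b) * indicator {a} b) \<partial>RU \<partial>RW \<partial>RS \<partial>RS)"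
    using nn_pot_expectation[OF sS, of "\<lambda>(u, b). indicator {a} b"] by simp
  also have "\<dots> = (\<integral>\<^sup>+z. \<integral>\<^sup>+s'. \<integral>\<^sup>+w. \<integral>\<^sup>+u. (\<Sum>a'\<in>UNIV. dp s z s' w u a' a) \<partial>RU \<partial>RW \<partial>RS \<partial>RS)"
    by (simp add: indicator_def if_distrib[where f="\<lambda>x. _ * x"] sS cong: if_cong)
  also have "\<dots> = (\<integral>\<^sup>+z. \<integral>\<^sup>+s'. \<integral>\<^sup>+u. \<integral>\<^sup>+w. (\<Sum>a'\<in>UNIV. dp s z s' w u a' a) \<partial>RW \<partial>RU \<partial>RS \<partial>RS)"
    by (intro nn_integral_cong WU.Fubini'[symmetric]) (measurable; rule sS)
  also have "\<dots> = (\<integral>\<^sup>+z. \<integral>\<^sup>+u. \<integral>\<^sup>+s'. \<integral>\<^sup>+w. (\<Sum>a'\<in>UNIV. dp s z s' w u a' a) \<partial>RW \<partial>RS \<partial>RU \<partial>RS)"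
    by (intro nn_integral_cong SU.Fubini'[symmetric]) (measurable; rule sS)
  also have "\<dots> = (\<integral>\<^sup>+u. \<integral>\<^sup>+z. \<integral>\<^sup>+s'. \<integral>\<^sup>+w. (\<Sum>a'\<in>UNIV. dp s z s' w u a' a) \<partial>RW \<partial>RS \<partial>RS \<partial>RU)"
    by (intro SU.Fubini'[symmetric]) (measurable; rule sS)
  also have "\<dots> = (\<integral>\<^sup>+u. \<integral>\<^sup>+s'. \<integral>\<^sup>+z. \<integral>\<^sup>+w. (\<Sum>a'\<in>UNIV. dp s z s' w u a' a) \<partial>RW \<partial>RS \<partial>RS \<partial>RU)"
    by (intro nn_integral_cong SS.Fubini'[symmetric]) (measurable; rule sS)
  also have "\<dots> = (\<integral>\<^sup>+u. PU u * (dens_sua s u a / dens_su s u) \<partial>RU)"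
  proof (intro nn_integral_cong_AE)
    show "AE u in RU. (\<integral>\<^sup>+s'. \<integral>\<^sup>+z. \<integral>\<^sup>+w. (\<Sum>a'\<in>UNIV. dp s z s' w u a' a) \<partial>RW \<partial>RS \<partial>RS) =
        PU u * (dens_sua s u a / dens_su s u)"
      using AE_dens_pot_su_eq[OF s, of a] AE_space
    proof eventually_elim
      case (elim u)
      show ?case
      proof (cases "PU u = 0")
        case True
        have "(\<Sum>a'\<in>UNIV. dp s z s' w u a' a) = 0" for z s' w
          using sum_dens_pot_le[OF sS, of z s' w u a] dens_zswu_zero[OF True, of z s' w] sum_nonneg[of UNIV "\<lambda>a'. dp s z s' w u a' a"] sS by simp
        with True show ?thesis by simp
      next
        case False
        then have "0 < PU u" by (simp add: less_le)
        with elim pot_given_lat[OF s _ this, of a] show ?thesis by simp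
      qed
    qed
  qed
  finally show ?thesis .
qed

subsection \<open>Bridge functions\<close>

text \<open>The part of \<open>bridge\<close> at a single \<open>s\<close>, at almost every instead of every \<open>z\<close>.\<close>

definition bridge_at :: "'s \<Rightarrow> 'a \<Rightarrow> ('w \<Rightarrow> real) \<Rightarrow> bool" where
  "bridge_at s a h \<longleftrightarrow>
    h \<in> borel_measurable RW \<and>
    integrable RW (\<lambda>w. (h w)\<^sup>2 * p_meas RS p w) \<and>
    (AE z in RS. z \<in> supp_prev RS RW p \<longrightarrow>
      integrable RW (\<lambda>w. h w * p_meas_given RW p w z s) \<and>
      p_act_given RW p a z s = (\<integral>w. h w * p_meas_given RW p w z s \<partial>RW))"

text \<open>This is k(u), with value 0 where p(u) = 0.\<close>

definition bridge_mean :: "('w \<Rightarrow> real) \<Rightarrow> 'u \<Rightarrow> real" where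
  "bridge_mean h u = (\<integral>w. h w * dens_wu w u \<partial>RW) / PU u"

lemma bridge_mean_measurable[measurable]:
  assumes [measurable]: "h \<in> borel_measurable RW"
  shows "bridge_mean h \<in> borel_measurable RU"
  unfolding bridge_mean_def[abs_def] by measurable

lemma dens_wu_zero: "w \<in> space RW \<Longrightarrow> u \<in> space RU \<Longrightarrow> PU u = 0 \<Longrightarrow> dens_wu w u = 0"
  using ennreal_dens_wu[of w u] by (simp add: dens_zswu_zero)

lemma p_lat_bridge_mean: "u \<in> space RU \<Longrightarrow> PU u * bridge_mean h u = (\<integral>w. h w * dens_wu w u \<partial>RW)"
  by (cases "PU u = 0") (simp_all add: bridge_mean_def dens_wu_zero cong: Bochner_Integration.integral_cong)

text \<open>By \<open>dens_zswu_eq\<close> the density at (z, s, u) is, as a function of w, a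
  constant multiple of p(w, u). So given U = u, the mean of h(W) is the same for all (z, s).\<close>

lemma dens_zsu_bridge_mean:
  assumes "z \<in> space RS" "s \<in> space RS" "u \<in> space RU"
  shows "bridge_mean h u * dens_zsu z s u = (\<integral>w. h w * dens_zswu z s w u \<partial>RW)"
proof (cases "PU u = 0")
  case True
  then show ?thesis by (simp add: bridge_mean_def dens_zswu_zero)
next
  case False
  have "(\<integral>w. h w * dens_zswu z s w u \<partial>RW) = (\<integral>w. (h w * dens_wu w u) * (dens_zsu z s u / PU u) \<partial>RW)"
    using False assms by (intro Bochner_Integration.integral_cong) (auto simp: dens_zswu_eq less_le)
  then show ?thesis by (simp add: bridge_mean_def)
qed

lemma dens_zsu_zero: "z \<in> space RS \<Longrightarrow> s \<in> space RS \<Longrightarrow> u \<in> space RU \<Longrightarrow> PU u = 0 \<Longrightarrow> dens_zsu z s u = 0"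
  using ennreal_dens_zsu[of z s u] by (simp add: dens_zswu_zero)

lemma dens_zsua_zero: "PU u = 0 \<Longrightarrow> dens_zsua z s u a = 0"
  by (simp add: dens_zsua_def dens_zero)

lemma p_meas_nonneg[simp]: "0 \<le> p_meas RS p w"
  by (auto simp: p_meas_def split_beta' intro!: Bochner_Integration.integral_nonneg)

lemma p_meas_measurable[measurable]: "p_meas RS p \<in> borel_measurable RW"
  unfolding p_meas_def[abs_def] by measurable

text \<open>The second moment of h(W), written over the joint density of W and U. It follows that
  the inner integral is finite for almost every u.\<close>

lemma nn_bridge_square_finite:
  assumes [measurable]: "h \<in> borel_measurable RW" and "integrable RW (\<lambda>w. (h w)\<^sup>2 * p_meas RS p w)"
  shows "(\<integral>\<^sup>+u. \<integral>\<^sup>+w. (h w)\<^sup>2 * dens_wu w u \<partial>RW \<partial>RU) < \<infinity>"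
proof -
  have "(\<integral>\<^sup>+u. \<integral>\<^sup>+w. (h w)\<^sup>2 * dens_wu w u \<partial>RW \<partial>RU) = (\<integral>\<^sup>+w. \<integral>\<^sup>+u. (h w)\<^sup>2 * dens_wu w u \<partial>RU \<partial>RW)"
    by (rule WU.Fubini') measurable
  also have "\<dots> = (\<integral>\<^sup>+w. ennreal ((h w)\<^sup>2) * (\<integral>\<^sup>+u. dens_wu w u \<partial>RU) \<partial>RW)"
    by (intro nn_integral_cong) (simp add: ennreal_mult nn_integral_cmult)
  also have "\<dots> = (\<integral>\<^sup>+w. (h w)\<^sup>2 * p_meas RS p w \<partial>RW)"
    by (intro nn_integral_cong_AE, rule eventually_mono[OF AE_p_meas])
      (simp add: ennreal_mult)
  also have "\<dots> < \<infinity>"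
    using assms(2) by (subst nn_integral_eq_integral) auto
  finally show ?thesis .
qed

text \<open>Jensen's inequality, from \<open>0 \<le> \<integral>(h(w) - k(u))\<^sup>2 p(w, u) dw\<close> with \<open>k = bridge_mean h\<close>.\<close>

lemma bridge_mean_square:
  assumes [measurable]: "h \<in> borel_measurable RW" "u \<in> space RU" and fin: "(\<integral>\<^sup>+w. (h w)\<^sup>2 * dens_wu w u \<partial>RW) < \<infinity>"
  shows "integrable RW (\<lambda>w. h w * dens_wu w u)"
    and "ennreal ((bridge_mean h u)\<^sup>2 * PU u) \<le> (\<integral>\<^sup>+w. (h w)\<^sup>2 * dens_wu w u \<partial>RW)"
proof -
  have r: "integrable RW (\<lambda>w. dens_wu w u)" "(\<integral>w. dens_wu w u \<partial>RW) = PU u"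
    using nn_dens_wu[of u] assms(2) by (auto simp: integrable_iff_bounded integral_eq_nn_integral)
  have h2: "integrable RW (\<lambda>w. (h w)\<^sup>2 * dens_wu w u)"
    using fin by (simp add: integrable_iff_bounded)
  show hr: "integrable RW (\<lambda>w. h w * dens_wu w u)"
  proof (rule Bochner_Integration.integrable_bound[OF Bochner_Integration.integrable_add[OF r(1) h2]])
    from mult_right_mono[OF abs_le_one_plus_square] have "\<bar>h w\<bar> * dens_wu w u \<le> (1 + (h w)\<^sup>2) * dens_wu w u" for w
      by simp
    then show "AE w in RW. norm (h w * dens_wu w u) \<le> norm (dens_wu w u + (h w)\<^sup>2 * dens_wu w u)"
      by (intro AE_I2) (simp add: abs_mult algebra_simps)
  qed simp
  have "0 \<le> (\<integral>w. (h w - bridge_mean h u)\<^sup>2 * dens_wu w u \<partial>RW)"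
    by (intro Bochner_Integration.integral_nonneg) simp
  also have "\<dots> =
      (\<integral>w. (h w)\<^sup>2 * dens_wu w u - 2 * bridge_mean h u * (h w * dens_wu w u) + (bridge_mean h u)\<^sup>2 * dens_wu w u \<partial>RW)"
    by (intro Bochner_Integration.integral_cong) (auto simp: power2_eq_square algebra_simps)
  also have "\<dots> =
      (\<integral>w. (h w)\<^sup>2 * dens_wu w u \<partial>RW) - 2 * bridge_mean h u * (PU u * bridge_mean h u) + (bridge_mean h u)\<^sup>2 * PU u"
    using r h2 hr assms(2) by (simp add: p_lat_bridge_mean)
  finally have "(bridge_mean h u)\<^sup>2 * PU u \<le> (\<integral>w. (h w)\<^sup>2 * dens_wu w u \<partial>RW)"
    by (simp add: power2_eq_square algebra_simps)
  then show "ennreal ((bridge_mean h u)\<^sup>2 * PU u) \<le> (\<integral>\<^sup>+w. (h w)\<^sup>2 * dens_wu w u \<partial>RW)"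
    using h2 by (subst nn_integral_eq_integral) (auto intro: ennreal_leI)
qed

text \<open>Admits g - k as a test function for completeness: g lies between 0 and 1, and the second
  moment of k is bounded by that of h(W).\<close>

lemma integrable_residual_square:
  assumes s: "s \<in> cur_support X t" and h[measurable]: "h \<in> borel_measurable RW"
    and "integrable RW (\<lambda>w. (h w)\<^sup>2 * p_meas RS p w)"
  shows "integrable (Om X) (\<lambda>\<omega>. (dens_sua s (lat X (t - 1) \<omega>) a / dens_su s (lat X (t - 1) \<omega>) - bridge_mean h (lat X (t - 1) \<omega>))\<^sup>2)"
proof -
  have sS[measurable]: "s \<in> space RS" using s by (simp add: supp_cur_def)
  have AE: "AE u in RU. (\<integral>\<^sup>+w. (h w)\<^sup>2 * dens_wu w u \<partial>RW) < \<infinity>"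
    using nn_bridge_square_finite[OF assms(2,3)] by (intro AE_nn_integral_finite) simp_all
  let ?\<nu> = "\<lambda>u. dens_sua s u a / dens_su s u - bridge_mean h u"
  have "(\<integral>\<^sup>+\<omega>. (?\<nu> (lat X (t - 1) \<omega>))\<^sup>2 \<partial>Om X) = (\<integral>\<^sup>+u. ennreal (PU u) * ennreal ((?\<nu> u)\<^sup>2) \<partial>RU)"
    by (rule distributed_nn_integral[OF dist_lat, symmetric]) measurable
  also have "\<dots> \<le> (\<integral>\<^sup>+u. 2 * ennreal (PU u) + 2 * (\<integral>\<^sup>+w. (h w)\<^sup>2 * dens_wu w u \<partial>RW) \<partial>RU)"
  proof (intro nn_integral_mono_AE, use AE AE_space in eventually_elim)
    case (elim u)
    show ?case
    proof (cases "PU u = 0")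
      case False
      then have PU: "0 < PU u" by (simp add: less_le)
      have g: "0 \<le> dens_sua s u a / dens_su s u" "dens_sua s u a / dens_su s u \<le> 1"
        using ennreal_dens_su(1)[OF s elim(2) PU] ennreal_dens_sua(3)[OF s elim(2) PU, of a] by simp_all
      \<comment> \<open>Adding (x + y)^2 \<ge> 0 to the left gives 2 x^2 + 2 y^2, and x^2 \<le>
        1.\<close>
      have "(x - y)\<^sup>2 \<le> 2 + 2 * y\<^sup>2" if "0 \<le> x" "x \<le> 1" for x y :: real
      proof -
        have "x\<^sup>2 \<le> 1" using that by (simp add: power_le_one)
        moreover have "0 \<le> (x + y)\<^sup>2" by simp
        ultimately show ?thesis by (simp add: power2_eq_square algebra_simps)
      qed
      from mult_left_mono[OF this[OF g], of "PU u" "bridge_mean h u"]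
      have "ennreal (PU u * (?\<nu> u)\<^sup>2) \<le> ennreal (2 * PU u + 2 * ((bridge_mean h u)\<^sup>2 * PU u))"
        by (intro ennreal_leI) (simp add: algebra_simps)
      also have "\<dots> = 2 * ennreal (PU u) + 2 * ennreal ((bridge_mean h u)\<^sup>2 * PU u)"
        by (simp add: ennreal_mult)
      also have "\<dots> \<le> 2 * ennreal (PU u) + 2 * (\<integral>\<^sup>+w. (h w)\<^sup>2 * dens_wu w u \<partial>RW)"
        by (intro add_left_mono mult_left_mono bridge_mean_square elim h) simp
      finally show ?thesis by (simp add: ennreal_mult)
    qed simp
  qed
  also have "\<dots> = 2 * (\<integral>\<^sup>+u. PU u \<partial>RU) + 2 * (\<integral>\<^sup>+u. \<integral>\<^sup>+w. (h w)\<^sup>2 * dens_wu w u \<partial>RW \<partial>RU)"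
    by (simp add: nn_integral_add nn_integral_cmult)
  also have "\<dots> < \<infinity>"
    using nn_bridge_square_finite[OF assms(2,3)] by (simp add: nn_p_lat ennreal_mult_less_top)
  finally show ?thesis
    by (simp add: integrable_iff_bounded)
qed

text \<open>Both sides of the bridge equation at (z, s) are rewritten as integrals over u, by Fubini
  in (w, u): the left one with \<open>dens_zsua_eq\<close>, the right one with
  \<open>dens_zsu_bridge_mean\<close>. Their difference is the conditional mean of g - k.\<close>

lemma bridge_at_conditional:
  assumes s: "s \<in> cur_support X t" and z[measurable]: "z \<in> space RS"
    and fin: "(\<integral>\<^sup>+w. \<integral>\<^sup>+u. dens_zswu z s w u \<partial>RU \<partial>RW) < \<infinity>"
    and h[measurable]: "h \<in> borel_measurable RW"
    and int: "integrable RW (\<lambda>w. h w * p_meas_given RW p w z s)"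
    and eq: "p_act_given RW p a z s = (\<integral>w. h w * p_meas_given RW p w z s \<partial>RW)"
  shows "integrable RU (\<lambda>u. (dens_sua s u a / dens_su s u - bridge_mean h u) * p_lat_given X t u z s)"
    and "(\<integral>u. (dens_sua s u a / dens_su s u - bridge_mean h u) * p_lat_given X t u z s \<partial>RU) = 0"
proof -
  have sS[measurable]: "s \<in> space RS" using s by (simp add: supp_cur_def)
  let ?P = "p_pair RW p z s"
  have reg: "AE w in RW. regular z s w" by (rule AE_regular_w[OF z sS fin])
  have lat_given: "p_lat_given X t u z s = dens_zsu z s u / ?P" if [measurable]: "u \<in> space RU" for u
  proof -
    have "(\<integral>(w, a). d z s w u a \<partial>(RW \<Otimes>\<^sub>M actions)) = enn2real (\<integral>\<^sup>+(w, a). d z s w u a \<partial>(RW \<Otimes>\<^sub>M actions))"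
      by (subst integral_eq_nn_integral) (auto simp: split_beta')
    also have "(\<integral>\<^sup>+(w, a). d z s w u a \<partial>(RW \<Otimes>\<^sub>M actions)) = dens_zsu z s u"
      by (simp add: split_beta' nn_integral_pair_finite ennreal_dens_zsu[OF z sS that, unfolded dens_zswu_def])
    finally show ?thesis by (simp add: p_lat_given_def)
  qed
  have I: "integrable (RW \<Otimes>\<^sub>M RU) (\<lambda>(w, u). d z s w u a)"
  proof (rule integrableI_nonneg)
    have "(\<integral>\<^sup>+x. (case x of (w, u) \<Rightarrow> d z s w u a) \<partial>(RW \<Otimes>\<^sub>M RU)) = (\<integral>\<^sup>+w. \<integral>\<^sup>+u. d z s w u a \<partial>RU \<partial>RW)"
      by (subst RU.nn_integral_fst[symmetric]) simp_all
    also have "\<dots> \<le> (\<integral>\<^sup>+w. \<integral>\<^sup>+u. dens_zswu z s w u \<partial>RU \<partial>RW)"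
      by (intro nn_integral_mono ennreal_leI) (auto simp: dens_zswu_def intro!: member_le_sum)
    finally show "(\<integral>\<^sup>+x. (case x of (w, u) \<Rightarrow> d z s w u a) \<partial>(RW \<Otimes>\<^sub>M RU)) < \<infinity>"
      using fin by (rule order.strict_trans1)
  qed auto
  have qa: "integrable RU (\<lambda>u. dens_zsua z s u a)" "(\<integral>u. dens_zsua z s u a \<partial>RU) =
      (\<integral>w. p (z, s, w, a) \<partial>RW)"
    unfolding dens_zsua_def obs_eq by (rule WU.integrable_snd[OF I], rule WU.Fubini_integral[OF I])
  have gq: "dens_sua s u a / dens_su s u * dens_zsu z s u = dens_zsua z s u a" if "u \<in> space RU" for u
    using dens_zsua_eq[OF s that _ z, of a] dens_zsu_zero[OF z sS that] dens_zsua_zero[of u z s a]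
    by (cases "PU u = 0") (auto simp: less_le)
  have f: "(dens_sua s u a / dens_su s u - bridge_mean h u) * p_lat_given X t u z s =
      (dens_zsua z s u a - bridge_mean h u * dens_zsu z s u) / ?P"
    if "u \<in> space RU" for u
    using gq[OF that] by (simp add: lat_given that left_diff_distrib diff_divide_distrib)
  have main: "integrable RU (\<lambda>u. (dens_zsua z s u a - bridge_mean h u * dens_zsu z s u) / ?P) \<and>
    (\<integral>u. (dens_zsua z s u a - bridge_mean h u * dens_zsu z s u) / ?P \<partial>RU) = 0"
  \<comment> \<open>For \<open>?P = 0\<close> every quotient is 0 by convention and the claim is
    trivial.\<close>
  proof (cases "?P = 0")
    case False
    then have hp: "integrable RW (\<lambda>w. h w * (\<Sum>a\<in>UNIV. p (z, s, w, a)))"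
      using integrable_mult_right[OF int, of ?P] by (simp add: p_meas_given_def)
    have "(\<integral>w. p (z, s, w, a) \<partial>RW) / ?P = (\<integral>w. h w * (\<Sum>a\<in>UNIV. p (z, s, w, a)) \<partial>RW) / ?P"
      using eq by (simp add: p_meas_given_def p_act_given_def)
    then have hp_eq: "(\<integral>w. p (z, s, w, a) \<partial>RW) = (\<integral>w. h w * (\<Sum>a\<in>UNIV. p (z, s, w, a)) \<partial>RW)"
      using False by simp
    \<comment> \<open>Integrating the absolute value over u first leaves h against the observed
      density, so the integrability demanded in \<open>bridge\<close> is what justifies
      Fubini.\<close>
    have J: "integrable (RW \<Otimes>\<^sub>M RU) (\<lambda>(w, u). h w * dens_zswu z s w u)"
      unfolding integrable_iff_bounded
    proof
      have "(\<integral>\<^sup>+x. norm (case x of (w, u) \<Rightarrow> h w * dens_zswu z s w u) \<partial>(RW \<Otimes>\<^sub>M RU)) =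
          (\<integral>\<^sup>+w. \<integral>\<^sup>+u. norm (h w * dens_zswu z s w u) \<partial>RU \<partial>RW)"
        by (subst RU.nn_integral_fst[symmetric]) simp_all
      also have "\<dots> = (\<integral>\<^sup>+w. norm (h w * (\<Sum>a\<in>UNIV. p (z, s, w, a))) \<partial>RW)"
      proof (intro nn_integral_cong_AE, use reg AE_space in eventually_elim)
        case (elim w)
        have "(\<integral>\<^sup>+u. norm (h w * dens_zswu z s w u) \<partial>RU) = ennreal \<bar>h w\<bar> * (\<integral>\<^sup>+u. dens_zswu z s w u \<partial>RU)"
          using elim by (simp add: abs_mult ennreal_mult nn_integral_cmult)
        also have "(\<integral>\<^sup>+u. dens_zswu z s w u \<partial>RU) = ennreal (\<Sum>a\<in>UNIV. p (z, s, w, a))"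
          using elim by (subst ennreal_obs(4)) (auto simp: nn_integral_eq_integral ennreal_obs(3)[OF z sS] z sS)
        finally show ?case by (simp add: abs_mult ennreal_mult sum_nonneg)
      qed
      also have "\<dots> < \<infinity>" using hp by (simp add: integrable_iff_bounded)
      finally show "(\<integral>\<^sup>+x. norm (case x of (w, u) \<Rightarrow> h w * dens_zswu z s w u) \<partial>(RW \<Otimes>\<^sub>M RU)) < \<infinity>" .
    qed simp
    have k_int: "integrable RU (\<lambda>u. bridge_mean h u * dens_zsu z s u)"
      using WU.integrable_snd[OF J]
      by (rule Bochner_Integration.integrable_cong[THEN iffD2, OF refl dens_zsu_bridge_mean[OF z sS], rotated])
    have "(\<integral>u. bridge_mean h u * dens_zsu z s u \<partial>RU) = (\<integral>u. \<integral>w. h w * dens_zswu z s w u \<partial>RW \<partial>RU)"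
      by (intro Bochner_Integration.integral_cong refl) (simp add: dens_zsu_bridge_mean z sS)
    also have "\<dots> = (\<integral>w. \<integral>u. h w * dens_zswu z s w u \<partial>RU \<partial>RW)"
      by (rule WU.Fubini_integral[OF J])
    also have "\<dots> = (\<integral>w. h w * (\<Sum>a\<in>UNIV. p (z, s, w, a)) \<partial>RW)"
    proof (rule integral_cong_AE)
      show "AE w in RW. (\<integral>u. h w * dens_zswu z s w u \<partial>RU) = h w * (\<Sum>a\<in>UNIV. p (z, s, w, a))"
        using reg AE_space by eventually_elim (simp add: ennreal_obs(4) z sS)
    qed measurable
    finally show ?thesis
      using qa k_int hp_eq by simp
  qed simp
  show "integrable RU (\<lambda>u. (dens_sua s u a / dens_su s u - bridge_mean h u) * p_lat_given X t u z s)"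
    using main by (simp add: f cong: Bochner_Integration.integrable_cong)
  show "(\<integral>u. (dens_sua s u a / dens_su s u - bridge_mean h u) * p_lat_given X t u z s \<partial>RU) = 0"
    using main by (simp add: f cong: Bochner_Integration.integral_cong)
qed

lemma pot_prob_bridge_at:
  assumes s: "s \<in> cur_support X t" and b: "bridge_at s a h"
  shows "pot_prob X t s a = (\<integral>w. h w * p_meas RS p w \<partial>RW)"
proof -
  have sS[measurable]: "s \<in> space RS" using s by (simp add: supp_cur_def)
  have h[measurable]: "h \<in> borel_measurable RW" and h2: "integrable RW (\<lambda>w. (h w)\<^sup>2 * p_meas RS p w)"
    and br: "AE z in RS. z \<in> supp_prev RS RW p \<longrightarrow>
      integrable RW (\<lambda>w. h w * p_meas_given RW p w z s) \<and>
      p_act_given RW p a z s = (\<integral>w. h w * p_meas_given RW p w z s \<partial>RW)"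
    using b by (auto simp: bridge_at_def)
  let ?\<nu> = "\<lambda>u. dens_sua s u a / dens_su s u - bridge_mean h u"
  have "AE \<omega> in Om X.
          integrable RU (\<lambda>u. ?\<nu> u * p_lat_given X t u (st X (t - 1) \<omega>) s) \<and>
          (\<integral>u. ?\<nu> u * p_lat_given X t u (st X (t - 1) \<omega>) s \<partial>RU) = 0"
  proof (rule AE_st_prev)
    show "AE z in RS. z \<in> supp_prev RS RW p \<longrightarrow>
          integrable RU (\<lambda>u. ?\<nu> u * p_lat_given X t u z s) \<and>
          (\<integral>u. ?\<nu> u * p_lat_given X t u z s \<partial>RU) = 0"
      using br AE_nn_cur_finite[OF sS]
      by eventually_elim (use bridge_at_conditional[OF s _ _ h] in \<open>auto simp: supp_prev_def\<close>)
  qed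
  then have "AE \<omega> in Om X. ?\<nu> (lat X (t - 1) \<omega>) = 0"
    using complete[unfolded completeness_def, rule_format, OF s, of ?\<nu>] integrable_residual_square[OF s h h2, of a]
    by simp
  then have \<nu>: "AE u in RU. 0 < PU u \<longrightarrow> ?\<nu> u = 0"
    by (subst (asm) distributed_AE2[OF dist_lat]) auto
  \<comment> \<open>Fubini for h against p(w, u) requires absolute integrability. The bound by 1 +
    h^2 reduces it to the total mass 1 and the second moment of h(W).\<close>
  have J: "integrable (RW \<Otimes>\<^sub>M RU) (\<lambda>(w, u). h w * dens_wu w u)"
    unfolding integrable_iff_bounded
  proof
    from mult_right_mono[OF abs_le_one_plus_square] have le: "\<bar>h w\<bar> * dens_wu w u \<le> (1 + (h w)\<^sup>2) * dens_wu w u" for w u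
      by simp
    have "(\<integral>\<^sup>+x. norm (case x of (w, u) \<Rightarrow> h w * dens_wu w u) \<partial>(RW \<Otimes>\<^sub>M RU)) \<le>
        (\<integral>\<^sup>+x. (case x of (w, u) \<Rightarrow> (1 + (h w)\<^sup>2) * dens_wu w u) \<partial>(RW \<Otimes>\<^sub>M RU))"
      by (intro nn_integral_mono ennreal_leI) (auto simp: abs_mult le)
    also have "\<dots> = (\<integral>\<^sup>+u. \<integral>\<^sup>+w. (1 + (h w)\<^sup>2) * dens_wu w u \<partial>RW \<partial>RU)"
      by (subst WU.nn_integral_snd[symmetric]) simp_all
    also have "\<dots> = (\<integral>\<^sup>+u. (\<integral>\<^sup>+w. dens_wu w u \<partial>RW) + (\<integral>\<^sup>+w. (h w)\<^sup>2 * dens_wu w u \<partial>RW) \<partial>RU)"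
      by (intro nn_integral_cong, subst nn_integral_add[symmetric]) (auto simp: algebra_simps)
    also have "\<dots> = (\<integral>\<^sup>+u. \<integral>\<^sup>+w. dens_wu w u \<partial>RW \<partial>RU) + (\<integral>\<^sup>+u. \<integral>\<^sup>+w. (h w)\<^sup>2 * dens_wu w u \<partial>RW \<partial>RU)"
      by (rule nn_integral_add) simp_all
    also have "(\<integral>\<^sup>+u. \<integral>\<^sup>+w. dens_wu w u \<partial>RW \<partial>RU) = 1"
      using nn_p_lat by (simp add: nn_dens_wu cong: nn_integral_cong)
    also have "1 + (\<integral>\<^sup>+u. \<integral>\<^sup>+w. (h w)\<^sup>2 * dens_wu w u \<partial>RW \<partial>RU) < \<infinity>"
      using nn_bridge_square_finite[OF h h2] by simp
    finally show "(\<integral>\<^sup>+x. norm (case x of (w, u) \<Rightarrow> h w * dens_wu w u) \<partial>(RW \<Otimes>\<^sub>M RU)) < \<infinity>" .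
  qed simp
  have "pot_prob X t s a = enn2real (\<integral>\<^sup>+u. PU u * (dens_sua s u a / dens_su s u) \<partial>RU)"
    unfolding pot_prob_eq[OF s, symmetric] by (simp add: pot_prob_def)
  also have "\<dots> = (\<integral>u. PU u * (dens_sua s u a / dens_su s u) \<partial>RU)"
    by (rule integral_eq_nn_integral[symmetric]) auto
  also have "\<dots> = (\<integral>u. PU u * bridge_mean h u \<partial>RU)"
    using \<nu> by (intro integral_cong_AE) (auto elim!: eventually_mono simp: less_le simp del: times_divide_eq_right)
  also have "\<dots> = (\<integral>u. \<integral>w. h w * dens_wu w u \<partial>RW \<partial>RU)"
    by (intro Bochner_Integration.integral_cong refl) (simp add: p_lat_bridge_mean)
  also have "\<dots> = (\<integral>w. \<integral>u. h w * dens_wu w u \<partial>RU \<partial>RW)"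
    by (rule WU.Fubini_integral[OF J])
  also have "\<dots> = (\<integral>w. h w * p_meas RS p w \<partial>RW)"
  proof (rule integral_cong_AE)
    show "AE w in RW. (\<integral>u. h w * dens_wu w u \<partial>RU) = h w * p_meas RS p w"
      using AE_p_meas AE_space
    proof eventually_elim
      case (elim w)
      then have "(\<integral>u. dens_wu w u \<partial>RU) = p_meas RS p w"
        by (subst integral_eq_nn_integral)
         (auto simp flip: elim(1))
      then show ?case by simp
    qed
  qed measurable
  finally show ?thesis .
qed

lemma bridge_at_bridge:
  assumes "bridge RS RW p a h" "s \<in> cur_support X t"
  shows "bridge_at s a (\<lambda>w. h w s)"
  using assms unfolding bridge_def bridge_at_def by simp

lemma pot_prob_bridge:
  assumes "bridge RS RW p a h" "s \<in> cur_support X t"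
  shows "pot_prob X t s a = (\<integral>w. h w s * p_meas RS p w \<partial>RW)"
  using pot_prob_bridge_at[OF assms(2) bridge_at_bridge[OF assms]] .

end

subsection \<open>Two models with the same observed distribution\<close>

text \<open>The two models share only the action type and the reference measures of states and
  measurements. Sample space and latent space of \<open>Y\<close> may even have other types, since
  the latent mechanism is what cannot be observed.\<close>

locale imitation_pair = X: imitation_at X T t + Y: imitation_at Y T t
  for X :: "('m, 's, 'w, 'u, 'a::finite) imitation" and Y :: "('m2, 's, 'w, 'u2, 'a) imitation"
    and T t :: nat +
  assumes refS_eq: "refS Y = refS X" and refW_eq: "refW Y = refW X"
begin

lemmas [measurable] = X.p_measurable Y.p_measurable[unfolded refS_eq refW_eq]

text \<open>At the fixed s a bridge function of \<open>X\<close> is also one of \<open>Y\<close>, so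
  both probabilities are the same integral of h against p(w). What transfers is
  \<open>bridge_at\<close>, because the densities are compared at almost every z. The assumptions
  match the marginals: \<open>zw\<close> serves p(s) and all that is conditional on (z, s),
  \<open>wzs\<close> serves p(w), and \<open>zsw\<close> serves p(z) and thereby the support of S
  (t-1).\<close>

lemma pot_prob_agree:
  assumes s: "s \<in> cur_support X t"
    and zw: "AE z in refS X. AE w in refW X. \<forall>a. obs X t (z, s, w, a) = obs Y t (z, s, w, a)"
    and wzs: "AE w in refW X. AE z in refS X. AE s in refS X. \<forall>a. obs X t (z, s, w, a) = obs Y t (z, s, w, a)"
    and zsw: "AE z in refS X. AE s in refS X. AE w in refW X. \<forall>a. obs X t (z, s, w, a) = obs Y t (z, s, w, a)"
  shows "pot_prob Y t s a = pot_prob X t s a"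
proof -
  let ?S = "refS X" and ?W = "refW X" and ?p = "obs X t" and ?q = "obs Y t"
  note sf = X.sigma_finite
  have sS[measurable]: "s \<in> space ?S" using s by (simp add: supp_cur_def)
  have cur: "p_cur ?S ?W ?p s = p_cur ?S ?W ?q s"
    unfolding p_cur_def using zw
    by (intro integral_triple_finite_cong_AE) (auto simp: sf split_beta')
  then have sY: "s \<in> cur_support Y t"
    using s by (simp add: supp_cur_def refS_eq refW_eq)
  have meas: "AE w in ?W. p_meas ?S ?p w = p_meas ?S ?q w"
    using wzs AE_space
  proof eventually_elim
    case (elim w)
    then show ?case
      unfolding p_meas_def
      by (intro integral_triple_finite_cong_AE) (auto simp: sf split_beta')
  qed
  have prev: "AE z in ?S. p_prev ?S ?W ?p z = p_prev ?S ?W ?q z"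
    using zsw AE_space
  proof eventually_elim
    case (elim z)
    then show ?case
      unfolding p_prev_def
      by (intro integral_triple_finite_cong_AE) (auto simp: sf split_beta')
  qed
  note [measurable] = X.p_meas_measurable Y.p_meas_measurable[unfolded refS_eq refW_eq]
  obtain h where h: "bridge ?S ?W ?p a h"
    using X.bridge_ex unfolding bridge_existence_def by blast
  let ?h = "\<lambda>w. h w s"
  have bX: "X.bridge_at s a ?h" using X.bridge_at_bridge[OF h s] .
  have hm[measurable]: "?h \<in> borel_measurable ?W" using bX by (simp add: X.bridge_at_def)
  have "Y.bridge_at s a ?h"
    unfolding Y.bridge_at_def refS_eq refW_eq
  proof (intro conjI)
    have "integrable ?W (\<lambda>w. (?h w)\<^sup>2 * p_meas ?S ?p w)"
      using bX by (simp add: X.bridge_at_def)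
    then show "integrable ?W (\<lambda>w. (?h w)\<^sup>2 * p_meas ?S ?q w)"
      by (rule integrable_cong_AE_imp) (use meas in \<open>auto elim!: eventually_mono\<close>)
    have "AE z in ?S. z \<in> supp_prev ?S ?W ?p \<longrightarrow>
      integrable ?W (\<lambda>w. ?h w * p_meas_given ?W ?p w z s) \<and>
      p_act_given ?W ?p a z s = (\<integral>w. ?h w * p_meas_given ?W ?p w z s \<partial>?W)"
      using bX by (simp add: X.bridge_at_def)
    then show "AE z in ?S. z \<in> supp_prev ?S ?W ?q \<longrightarrow>
      integrable ?W (\<lambda>w. ?h w * p_meas_given ?W ?q w z s) \<and>
      p_act_given ?W ?q a z s = (\<integral>w. ?h w * p_meas_given ?W ?q w z s \<partial>?W)"
      using prev zw AE_space
    proof eventually_elim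
      case (elim z)
      note [measurable] = elim(4)
      have pair: "p_pair ?W ?p z s = p_pair ?W ?q z s"
        unfolding p_pair_def using elim(3)
        by (intro integral_pair_finite_cong_AE) (auto simp: split_beta')
      have act: "p_act_given ?W ?p a z s = p_act_given ?W ?q a z s"
        unfolding p_act_given_def pair using elim(3)
        by (intro arg_cong2[where f="(/)"] integral_cong_AE) (auto elim!: eventually_mono)
      have given: "AE w in ?W. ?h w * p_meas_given ?W ?p w z s = ?h w * p_meas_given ?W ?q w z s"
        using elim(3) by eventually_elim (simp add: p_meas_given_def pair)
      have m: "(\<lambda>w. ?h w * p_meas_given ?W ?p w z s) \<in> borel_measurable ?W"
        "(\<lambda>w. ?h w * p_meas_given ?W ?q w z s) \<in> borel_measurable ?W"
        unfolding p_meas_given_def by measurable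
      show ?case
        using elim(1,2) integral_cong_AE[OF m given] integrable_cong_AE[OF m given]
        by (simp add: supp_prev_def act)
    qed
  qed measurable
  from Y.pot_prob_bridge_at[OF sY this]
  have "pot_prob Y t s a = (\<integral>w. ?h w * p_meas ?S ?q w \<partial>?W)"
    by (simp add: refS_eq refW_eq)
  also have "\<dots> = (\<integral>w. ?h w * p_meas ?S ?p w \<partial>?W)"
    using meas by (intro integral_cong_AE) (auto elim!: eventually_mono)
  also have "\<dots> = pot_prob X t s a"
    using X.pot_prob_bridge_at[OF s bX] by simp
  finally show ?thesis .
qed

lemma opt_actions_cong: "(\<And>a. pot_prob Y t s a = pot_prob X t s a) \<Longrightarrow> opt_actions Y t s = opt_actions X t s"
  by (simp add: opt_actions_def is_arg_max_def)

lemma identified_pointwise: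
  assumes eq: "\<And>y. y \<in> space (obs_space (refS X) (refW X)) \<Longrightarrow> obs Y t y = obs X t y"
    and s: "s \<in> cur_support X t"
  shows "pot_prob Y t s a = pot_prob X t s a"
proof (rule pot_prob_agree[OF s])
  have sS: "s \<in> space (refS X)" using s by (simp add: supp_cur_def)
  have eq': "obs X t (z, s, w, a) = obs Y t (z, s, w, a)"
    if "z \<in> space (refS X)" "s \<in> space (refS X)" "w \<in> space (refW X)" for z s w a
    using that by (intro eq[symmetric]) (simp add: obs_space_def space_pair_measure)
  show "AE z in refS X. AE w in refW X. \<forall>a. obs X t (z, s, w, a) = obs Y t (z, s, w, a)"
    "AE w in refW X. AE z in refS X. AE s in refS X. \<forall>a. obs X t (z, s, w, a) = obs Y t (z, s, w, a)"
    "AE z in refS X. AE s in refS X. AE w in refW X. \<forall>a. obs X t (z, s, w, a) = obs Y t (z, s, w, a)"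
    using eq' sS by auto
qed

text \<open>Equal laws of finite mass have densities equal almost everywhere.
  \<open>pot_prob_agree\<close> uses this along three nestings of the variables; the nesting with s
  outermost leaves the exceptional null set of s.\<close>

lemma identified_distr:
  assumes eq: "distr (Om Y) (obs_space (refS X) (refW X)) (obs_var Y t) =
    distr (Om X) (obs_space (refS X) (refW X)) (obs_var X t)"
  shows "AE s in distr (Om X) (refS X) (st X t). \<forall>a. pot_prob Y t s a = pot_prob X t s a"
proof -
  let ?S = "refS X" and ?W = "refW X" and ?p = "obs X t" and ?q = "obs Y t"
  let ?O = "?S \<Otimes>\<^sub>M ?S \<Otimes>\<^sub>M ?W \<Otimes>\<^sub>M (actions :: 'a measure)"
  note sf = X.sigma_finite
  have "density ?O (\<lambda>y. ennreal (?p y)) = density ?O (\<lambda>y. ennreal (?q y))"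
    using eq distributed_distr_eq_density[OF X.dist_obs] distributed_distr_eq_density[OF Y.dist_obs]
    by (simp add: refS_eq refW_eq obs_space_def)
  moreover have "(\<integral>\<^sup>+y. ennreal (?p y) \<partial>?O) \<noteq> \<infinity>"
    using distributed_nn_integral[OF X.dist_obs, of "\<lambda>_. 1"]
    by (simp add: obs_space_def X.emeasure_space_1)
  ultimately have "AE y in ?O. ennreal (?p y) = ennreal (?q y)"
    by (subst (asm) finite_density_unique) auto
  then have "AE y in ?O. ennreal \<bar>?p y - ?q y\<bar> = 0"
    by (auto elim!: eventually_mono)
  \<comment> \<open>Nonnegative, and 0 exactly when the densities agree for all actions: the
    variables can be reordered under the integral before null sets are extracted.\<close>
  define \<delta> where "\<delta> z s w = ennreal (\<Sum>a\<in>UNIV. \<bar>?p (z, s, w, a) - ?q (z, s, w, a)\<bar>)" for z s w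
  have \<delta>_0: "\<delta> z s w = 0 \<longleftrightarrow> (\<forall>a. ?p (z, s, w, a) = ?q (z, s, w, a))" for z s w
    by (simp add: \<delta>_def sum_nonneg_eq_0_iff sum_nonneg flip: ennreal_0)
  have "(\<integral>\<^sup>+z. \<integral>\<^sup>+s. \<integral>\<^sup>+w. \<delta> z s w \<partial>?W \<partial>?S \<partial>?S) = (\<integral>\<^sup>+y. ennreal \<bar>?p y - ?q y\<bar> \<partial>?O)"
    unfolding \<delta>_def by (subst nn_integral_quad_finite) (simp_all add: sf)
  also have "\<dots> = 0"
    using \<open>AE y in ?O. ennreal \<bar>?p y - ?q y\<bar> = 0\<close> by (subst nn_integral_0_iff_AE) auto
  finally have zsw: "(\<integral>\<^sup>+z. \<integral>\<^sup>+s. \<integral>\<^sup>+w. \<delta> z s w \<partial>?W \<partial>?S \<partial>?S) = 0" .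
  have szw: "(\<integral>\<^sup>+s. \<integral>\<^sup>+z. \<integral>\<^sup>+w. \<delta> z s w \<partial>?W \<partial>?S \<partial>?S) = 0"
    unfolding zsw[symmetric] \<delta>_def by (rule X.SS.Fubini') measurable
  have "(\<integral>\<^sup>+w. \<integral>\<^sup>+z. \<integral>\<^sup>+s. \<delta> z s w \<partial>?S \<partial>?S \<partial>?W) = (\<integral>\<^sup>+z. \<integral>\<^sup>+w. \<integral>\<^sup>+s. \<delta> z s w \<partial>?S \<partial>?W \<partial>?S)"
    unfolding \<delta>_def by (rule X.SW.Fubini') measurable
  also have "\<dots> = 0"
    unfolding zsw[symmetric] \<delta>_def by (intro nn_integral_cong X.SW.Fubini') measurable
  finally have wzs: "(\<integral>\<^sup>+w. \<integral>\<^sup>+z. \<integral>\<^sup>+s. \<delta> z s w \<partial>?S \<partial>?S \<partial>?W) = 0" .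
  have AE_zsw: "AE z in ?S. AE s in ?S. AE w in ?W. \<forall>a. ?p (z, s, w, a) = ?q (z, s, w, a)"
    using zsw unfolding \<delta>_0[symmetric]
    by (rule nn_integral_triple_0_AE[rotated -1]) (simp_all add: sf \<delta>_def)
  have AE_szw: "AE s in ?S. AE z in ?S. AE w in ?W. \<forall>a. ?p (z, s, w, a) = ?q (z, s, w, a)"
    using szw unfolding \<delta>_0[symmetric]
    by (rule nn_integral_triple_0_AE[rotated -1]) (simp_all add: sf \<delta>_def)
  have AE_wzs: "AE w in ?W. AE z in ?S. AE s in ?S. \<forall>a. ?p (z, s, w, a) = ?q (z, s, w, a)"
    using wzs unfolding \<delta>_0[symmetric]
    by (rule nn_integral_triple_0_AE[rotated -1]) (simp_all add: sf \<delta>_def)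
  show ?thesis
    unfolding distributed_distr_eq_density[OF X.dist_st]
  proof (subst AE_density)
    show "AE s in ?S. 0 < ennreal (p_cur ?S ?W ?p s) \<longrightarrow> (\<forall>a. pot_prob Y t s a = pot_prob X t s a)"
      using AE_szw AE_space
      by eventually_elim (auto intro!: pot_prob_agree AE_wzs AE_zsw simp: supp_cur_def)
  qed (use distributed_borel_measurable[OF X.dist_st] in simp)
qed

end

text \<open>Being identified is expressed as agreement between any two models with the same observed
  data. The data are taken once as the observed density, which fixes the values at every s in the
  support, and once as the observed law, which determines a density only up to null sets and hence
  gives almost every s. Ties are handled by comparing the whole set of maximisers.\<close>

theorem theorem4p8:
  fixes X :: "('m, 's, 'w, 'u, 'a::finite) imitation"
    and T :: nat
  assumes "imitation_model T X"
  shows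
    "(\<forall>t\<in>{1..T}. \<forall>a h.
         bridge (refS X) (refW X) (obs X t) a h \<longrightarrow>
         (\<forall>s\<in>cur_support X t.
            pot_prob X t s a = (\<integral>w. h w s * p_meas (refS X) (obs X t) w \<partial>refW X))) \<and>
     (\<forall>t\<in>{1..T}. \<forall>h.
         (\<forall>a. bridge (refS X) (refW X) (obs X t) a (h a)) \<longrightarrow>
         (\<forall>s\<in>cur_support X t.
            opt_actions X t s =
              {a. is_arg_max (\<lambda>a. \<integral>w. h a w s * p_meas (refS X) (obs X t) w \<partial>refW X) (\<lambda>_. True) a})) \<and>
     (\<forall>t\<in>{1..T}. \<forall>Y :: ('m2, 's, 'w, 'u2, 'a) imitation.
         imitation_model T Y \<longrightarrow> refS Y = refS X \<longrightarrow> refW Y = refW X \<longrightarrow>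
         (\<forall>y\<in>space (obs_space (refS X) (refW X)). obs Y t y = obs X t y) \<longrightarrow>
         (\<forall>s\<in>cur_support X t.
            (\<forall>a. pot_prob Y t s a = pot_prob X t s a) \<and> opt_actions Y t s = opt_actions X t s)) \<and>
     (\<forall>t\<in>{1..T}. \<forall>Y :: ('m2, 's, 'w, 'u2, 'a) imitation.
         imitation_model T Y \<longrightarrow> refS Y = refS X \<longrightarrow> refW Y = refW X \<longrightarrow>
         distr (Om Y) (obs_space (refS X) (refW X)) (obs_var Y t) =
           distr (Om X) (obs_space (refS X) (refW X)) (obs_var X t) \<longrightarrow>
         (AE s in distr (Om X) (refS X) (st X t).
            (\<forall>a. pot_prob Y t s a = pot_prob X t s a) \<and> opt_actions Y t s = opt_actions X t s))"
proof (intro conjI ballI allI impI)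
  fix t a h s
  assume "t \<in> {1..T}" and b: "bridge (refS X) (refW X) (obs X t) a h" "s \<in> cur_support X t"
  then interpret imitation_at X T t using assms by unfold_locales
  show "pot_prob X t s a = (\<integral>w. h w s * p_meas (refS X) (obs X t) w \<partial>refW X)"
    using b by (rule pot_prob_bridge)
next
  fix t h s
  assume "t \<in> {1..T}" and b: "\<forall>a. bridge (refS X) (refW X) (obs X t) a (h a)" "s \<in> cur_support X t"
  then interpret imitation_at X T t using assms by unfold_locales
  have "pot_prob X t s a = (\<integral>w. h a w s * p_meas (refS X) (obs X t) w \<partial>refW X)" for a
    using b by (intro pot_prob_bridge) simp_all
  then show "opt_actions X t s =
      {a. is_arg_max (\<lambda>a. \<integral>w. h a w s * p_meas (refS X) (obs X t) w \<partial>refW X) (\<lambda>_. True) a}"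
    by (simp add: opt_actions_def is_arg_max_def)
next
  fix t s a and Y :: "('m2, 's, 'w, 'u2, 'a) imitation"
  assume "t \<in> {1..T}" "imitation_model T Y" "refS Y = refS X" "refW Y = refW X"
    and eq: "\<forall>y\<in>space (obs_space (refS X) (refW X)). obs Y t y = obs X t y" "s \<in> cur_support X t"
  then interpret imitation_pair X Y T t using assms by unfold_locales
  show "pot_prob Y t s a = pot_prob X t s a"
    using eq by (intro identified_pointwise) simp_all
next
  fix t s and Y :: "('m2, 's, 'w, 'u2, 'a) imitation"
  assume "t \<in> {1..T}" "imitation_model T Y" "refS Y = refS X" "refW Y = refW X"
    and eq: "\<forall>y\<in>space (obs_space (refS X) (refW X)). obs Y t y = obs X t y" "s \<in> cur_support X t"
  then interpret imitation_pair X Y T t using assms by unfold_locales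
  show "opt_actions Y t s = opt_actions X t s"
    using eq by (intro opt_actions_cong identified_pointwise) simp_all
next
  fix t and Y :: "('m2, 's, 'w, 'u2, 'a) imitation"
  assume "t \<in> {1..T}" "imitation_model T Y" "refS Y = refS X" "refW Y = refW X"
    and eq: "distr (Om Y) (obs_space (refS X) (refW X)) (obs_var Y t) =
      distr (Om X) (obs_space (refS X) (refW X)) (obs_var X t)"
  then interpret imitation_pair X Y T t using assms by unfold_locales
  show "AE s in distr (Om X) (refS X) (st X t).
      (\<forall>a. pot_prob Y t s a = pot_prob X t s a) \<and> opt_actions Y t s = opt_actions X t s"
    using identified_distr[OF eq] by (rule eventually_mono) (auto intro!: opt_actions_cong)
qed

end
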